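(* Let $\Gamma\subseteq\mathbb{R}^n$ be a lattice, $E$ a finite list of elements of $\Gamma$, and $\mathcal{M}=(E,r,m)$ with $r(A)=\operatorname{rank}\langle A\rangle$ and $m(A)=|(\Gamma/\langle A\rangle)_{\mathrm{tor}}|$. For $A\subseteq E$ let $\mathrm{Ehr}_{\mathcal{Z}(A)}(t)$ be the Ehrhart polynomial of the zonotope $\mathcal{Z}(A)=\{\sum_{e\in A}\lambda_ee:0\le\lambda_e\le1\}$ with respect to $\Gamma$ (so $\mathrm{Ehr}_{\mathcal{Z}(A)}(k)=|k\mathcal{Z}(A)\cap\Gamma|$ for positive integers $k$). Then for $p_e\in[0,1]$, $$\mathbb{E}\bigl[\mathrm{Ehr}_{\mathcal{Z}(E_{\underline p})}(t)\bigr]=\mathbf{Ehr}_E\bigl((p_et)_{e\in E}\bigr),$$ and in particular, if $p_e=p\in(0,1]$ for all $e$, $$\mathbb{E}\bigl[\mathrm{Ehr}_{\mathcal{Z}(E_p)}(t)\bigr]=(pt)^{r(E)}\,T_{\mathcal{M}}\bigl(1+(pt)^{-1},1\bigr).$$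
   Context: $\mathbf{Ehr}_E(\underline v)=\sum_{B\subseteq E\text{ linearly independent}}m(B)\prod_{e\in B}v_e$ (the Brändén–Moci multivariate Ehrhart polynomial). $T_{\mathcal{M}}(x,y)=\sum_{A\subseteq E}m(A)(x-1)^{r(E)-r(A)}(y-1)^{|A|-r(A)}$. $E_{\underline p}$ is the random sublist containing each $e$ independently with probability $p_e$; $E_p$ the case all $p_e=p$. *)

theory Defs
  imports
    "HOL-Analysis.Analysis"
    "HOL-Probability.Probability"
    "HOL-Computational_Algebra.Polynomial"
    "HOL-Algebra.Coset"
begin

global_interpretation int_module: module "\<lambda>(k::int) (x::'a::real_vector). of_int k *\<^sub>R x"
  defines int_span = int_module.span
    and int_dependent = int_module.dependent
  by unfold_locales (simp_all add: scaleR_add_right scaleR_add_left)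

text \<open>
  A lattice need not have full rank: any discrete subgroup is allowed, presented by a basis that
  is linearly independent over the reals.
\<close>

definition is_lattice :: "'a::real_vector set \<Rightarrow> bool" where
  "is_lattice \<Gamma> \<longleftrightarrow> (\<exists>B. finite B \<and> independent B \<and> \<Gamma> = int_span B)"

definition group_rank :: "'a::real_vector set \<Rightarrow> nat" where
  "group_rank G = Max {card B | B. finite B \<and> B \<subseteq> G \<and> \<not> int_dependent B}"

definition add_group_of :: "'a::ab_group_add set \<Rightarrow> 'a monoid" where
  "add_group_of G = \<lparr>carrier = G, monoid.mult = (+), one = 0\<rparr>"

definition torsion :: "('a, 'b) monoid_scheme \<Rightarrow> 'a set" where
  "torsion G = {x \<in> carrier G. \<exists>k::nat. k > 0 \<and> x [^]\<^bsub>G\<^esub> k = \<one>\<^bsub>G\<^esub>}"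

text \<open>
  The list \<open>E\<close> may contain repeated vectors, so its sublists are represented by sets of
  positions \<open>A \<subseteq> {..<length E}\<close>.
\<close>

definition gen_subgroup :: "'a::real_vector list \<Rightarrow> nat set \<Rightarrow> 'a set" where
  "gen_subgroup E A = int_span ((!) E ` A)"

definition rk :: "'a::real_vector list \<Rightarrow> nat set \<Rightarrow> nat" where
  "rk E A = group_rank (gen_subgroup E A)"

definition multip :: "'a::real_vector set \<Rightarrow> 'a list \<Rightarrow> nat set \<Rightarrow> nat" where
  "multip \<Gamma> E A = card (torsion (add_group_of \<Gamma> Mod gen_subgroup E A))"

definition lin_indep_sublist :: "'a::real_vector list \<Rightarrow> nat set \<Rightarrow> bool" where
  "lin_indep_sublist E B \<longleftrightarrow> inj_on ((!) E) B \<and> independent ((!) E ` B)"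

definition zonotope :: "'a::real_vector list \<Rightarrow> nat set \<Rightarrow> 'a set" where
  "zonotope E A = {\<Sum>i\<in>A. c i *\<^sub>R (E ! i) | c. \<forall>i\<in>A. 0 \<le> c i \<and> c i \<le> 1}"

definition ehrhart_polynomial :: "'a::real_vector set \<Rightarrow> 'a set \<Rightarrow> real poly" where
  "ehrhart_polynomial \<Gamma> P =
     (THE q. \<forall>k::nat. k > 0 \<longrightarrow> poly q (real k) = real (card ((*\<^sub>R) (real k) ` P \<inter> \<Gamma>)))"

definition multivariate_ehrhart ::
    "'a::real_vector set \<Rightarrow> 'a list \<Rightarrow> (nat \<Rightarrow> real) \<Rightarrow> real" where
  "multivariate_ehrhart \<Gamma> E v =
     (\<Sum>B | B \<subseteq> {..<length E} \<and> lin_indep_sublist E B. real (multip \<Gamma> E B) * (\<Prod>i\<in>B. v i))"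

definition arith_tutte ::
    "'i set \<Rightarrow> ('i set \<Rightarrow> nat) \<Rightarrow> ('i set \<Rightarrow> nat) \<Rightarrow> real \<Rightarrow> real \<Rightarrow> real" where
  "arith_tutte S r m x y =
     (\<Sum>A\<in>Pow S. real (m A) * (x - 1) ^ (r S - r A) * (y - 1) ^ (card A - r A))"

definition random_sublist :: "'a list \<Rightarrow> (nat \<Rightarrow> real) \<Rightarrow> nat set pmf" where
  "random_sublist E p =
     map_pmf (\<lambda>\<omega>. {i \<in> {..<length E}. \<omega> i})
       (Pi_pmf {..<length E} False (\<lambda>i. bernoulli_pmf (p i)))"

end

theory Submission
  imports Defs
begin

text \<open>
  The heart of the matter is Stanley's formula: a zonotope generated by lattice vectors contains
  as many lattice points as all half-open parallelepipeds on its independent subfamilies together.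
  It follows by deletion and contraction. Passing from \<open>Z(A)\<close> to \<open>Z(A + e)\<close> prolongs every line
  section parallel to \<open>e\<close> by one half-open copy of \<open>e\<close>, so the number of lattice points grows by the
  lattice length of \<open>e\<close> times the number of points of the projected lattice in the projected
  zonotope. Half-open parallelepipeds obey the same recursion. Discreteness, unlike a chosen basis,
  visibly survives the projection, so the induction runs over discrete subgroups.
  A half-open parallelepiped on an independent family \<open>B\<close> is a set of coset representatives for the
  torsion of the quotient by \<open>B\<close>, and dilation by \<open>k\<close> multiplies its count by \<open>k ^ |B|\<close>; thus the
  Ehrhart polynomial is a sum over independent sublists, and the expectation replaces each
  indicator of \<open>B \<subseteq> A\<close> by the product of the probabilities.
\<close>

subsection \<open>Discrete subgroups and their projections\<close>

text \<open>Local finiteness is the form of discreteness that counting uses directly; closure under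
  subtraction yields negation and addition. No basis is mentioned, so the notion passes to
  projections.\<close>

definition discrete_subgroup :: "'a::real_normed_vector set \<Rightarrow> bool" where
  "discrete_subgroup G \<longleftrightarrow> 0 \<in> G \<and> (\<forall>x\<in>G. \<forall>y\<in>G. x - y \<in> G) \<and> (\<forall>R. finite {x \<in> G. norm x \<le> R})"

lemma discrete_subgroup_zero: "discrete_subgroup G \<Longrightarrow> 0 \<in> G"
  and discrete_subgroup_diff: "discrete_subgroup G \<Longrightarrow> x \<in> G \<Longrightarrow> y \<in> G \<Longrightarrow> x - y \<in> G"
  by (auto simp: discrete_subgroup_def)

lemma discrete_subgroup_add:
  assumes "discrete_subgroup G" "x \<in> G" "y \<in> G"
  shows "x + y \<in> G"
  using discrete_subgroup_diff[OF assms(1,2) discrete_subgroup_diff[OF assms(1) discrete_subgroup_zero[OF assms(1)] assms(3)]]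
  by simp

lemma discrete_subgroup_scale_nat:
  assumes "discrete_subgroup G" "x \<in> G"
  shows "real k *\<^sub>R x \<in> G"
proof (induction k)
  case 0
  then show ?case using discrete_subgroup_zero[OF assms(1)] by simp
next
  case (Suc k)
  then show ?case using discrete_subgroup_add[OF assms(1) Suc assms(2)] by (simp add: algebra_simps)
qed

lemma discrete_subgroup_scale_int:
  assumes "discrete_subgroup G" "x \<in> G"
  shows "of_int k *\<^sub>R x \<in> G"
proof (cases k)
  case (nonneg n)
  then show ?thesis using discrete_subgroup_scale_nat[OF assms, of n] by simp
next
  case (neg n)
  then have "of_int k *\<^sub>R x = 0 - real (Suc n) *\<^sub>R x"
    by (simp only: of_int_minus of_int_of_nat_eq) (simp add: algebra_simps)
  then show ?thesis
    using discrete_subgroup_diff[OF assms(1) discrete_subgroup_zero[OF assms(1)]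
        discrete_subgroup_scale_nat[OF assms, of "Suc n"]] by metis
qed

lemma discrete_subgroup_sum:
  assumes "discrete_subgroup G" "\<And>i. i \<in> A \<Longrightarrow> f i \<in> G"
  shows "sum f A \<in> G"
  using assms(2)
  by (induction A rule: infinite_finite_induct)
    (auto simp: discrete_subgroup_zero[OF assms(1)] discrete_subgroup_add[OF assms(1)])

lemma discrete_subgroup_finite_bounded:
  assumes "discrete_subgroup G" "bounded X"
  shows "finite (X \<inter> G)"
proof -
  obtain R where "\<forall>x\<in>X. norm x \<le> R" using assms(2) bounded_iff by blast
  then have "X \<inter> G \<subseteq> {x\<in>G. norm x \<le> R}" by auto
  then show ?thesis using assms(1) finite_subset unfolding discrete_subgroup_def by blast
qed

section \<open>Orthogonal projection along a vector\<close>

text \<open>A model of the quotient by the line of \<open>e\<close> inside the ambient type, so that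
  an induction can contract repeatedly without changing type. For \<open>e = 0\<close> division by
  zero makes it the identity.\<close>

definition proj_along :: "'a::real_inner \<Rightarrow> 'a \<Rightarrow> 'a" where
  "proj_along e x = x - ((x \<bullet> e) / (e \<bullet> e)) *\<^sub>R e"

lemma linear_proj_along: "linear (proj_along e)"
  by (rule linearI) (simp_all add: proj_along_def inner_add_left algebra_simps add_divide_distrib)

lemma proj_along_self: "proj_along e e = 0"
  by (cases "e = 0") (simp_all add: proj_along_def)

lemma proj_along_add_scale: "proj_along e (x + s *\<^sub>R e) = proj_along e x"
  by (simp add: linear_add[OF linear_proj_along] linear_scale[OF linear_proj_along] proj_along_self)

lemma proj_along_eqD:
  assumes "proj_along e x = proj_along e y"
  obtains s where "y = x + s *\<^sub>R e"
proof
  show "y = x + ((y \<bullet> e) / (e \<bullet> e) - (x \<bullet> e) / (e \<bullet> e)) *\<^sub>R e"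
    using assms by (simp add: proj_along_def algebra_simps)
qed

lemma proj_along_scale:
  assumes "k \<noteq> 0"
  shows "proj_along (k *\<^sub>R e) = proj_along e"
  using assms by (auto simp: proj_along_def fun_eq_iff)

text \<open>Subtracting an integer multiple of \<open>e\<close> brings the component of a preimage
  along \<open>e\<close> into [0, 1) without leaving \<open>G\<close>. A ball in the projection is
  thus covered by the image of a ball enlarged by \<open>norm e\<close>, which holds finitely many
  points.\<close>

lemma discrete_subgroup_proj_along:
  assumes G: "discrete_subgroup G" and e: "e \<in> G"
  shows "discrete_subgroup (proj_along e ` G)"
  unfolding discrete_subgroup_def
proof (intro conjI ballI allI)
  show "0 \<in> proj_along e ` G"
    using linear_0[OF linear_proj_along] discrete_subgroup_zero[OF G] by (metis imageI)
  show "x - y \<in> proj_along e ` G" if "x \<in> proj_along e ` G" "y \<in> proj_along e ` G" for x y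
  proof -
    obtain a b where "x = proj_along e a" "y = proj_along e b" "a \<in> G" "b \<in> G"
      using \<open>x \<in> _\<close> \<open>y \<in> _\<close> by blast
    moreover from this have "x - y = proj_along e (a - b)"
      by (simp add: linear_diff[OF linear_proj_along])
    ultimately show ?thesis using discrete_subgroup_diff[OF G] by blast
  qed
  fix R
  have "{y \<in> proj_along e ` G. norm y \<le> R} \<subseteq> proj_along e ` {x\<in>G. norm x \<le> R + norm e}"
  proof
    fix y assume "y \<in> {y \<in> proj_along e ` G. norm y \<le> R}"
    then obtain x where x: "x \<in> G" "y = proj_along e x" "norm y \<le> R" by auto
    define s where "s = (x \<bullet> e) / (e \<bullet> e)"
    define x' where "x' = y + frac s *\<^sub>R e"
    have "x' = x - of_int \<lfloor>s\<rfloor> *\<^sub>R e"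
      by (simp add: x'_def x proj_along_def s_def frac_def algebra_simps)
    then have "x' \<in> G"
      using discrete_subgroup_diff[OF G x(1) discrete_subgroup_scale_int[OF G e]] by simp
    moreover have "norm (frac s *\<^sub>R e) \<le> norm e"
      using frac_lt_1[of s] frac_ge_0[of s] by (simp add: mult_left_le_one_le)
    then have "norm x' \<le> R + norm e"
      unfolding x'_def using x(3) norm_triangle_ineq[of y "frac s *\<^sub>R e"] by linarith
    moreover have "proj_along e x' = y"
      unfolding \<open>x' = x - _\<close> x(2) using proj_along_add_scale[of e x "- of_int \<lfloor>s\<rfloor>"] by simp
    ultimately show "y \<in> proj_along e ` {x\<in>G. norm x \<le> R + norm e}" by auto
  qed
  then show "finite {y \<in> proj_along e ` G. norm y \<le> R}"
    using G finite_surj unfolding discrete_subgroup_def by blast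
qed

subsection \<open>Slicing along a lattice vector\<close>

text \<open>For a nonzero \<open>e\<close> in a discrete subgroup \<open>G\<close>, this is the
  index of the integer multiples of \<open>e\<close> in the group of points of \<open>G\<close> on
  the line through \<open>e\<close>.\<close>

definition lattice_length :: "'a::real_vector set \<Rightarrow> 'a \<Rightarrow> nat" where
  "lattice_length G e = card {s. 0 \<le> s \<and> s < 1 \<and> s *\<^sub>R e \<in> G}"

text \<open>The points of \<open>G\<close> on a parallel line form a coset of those on the line
  through \<open>e\<close>, so shifting the parameter by \<open>r\<close> modulo 1 is a bijection.
  The base point \<open>q\<close> itself may lie outside \<open>G\<close>.\<close>

lemma card_translated_segment:
  assumes G: "discrete_subgroup G" and e: "e \<in> G" and q: "q + r *\<^sub>R e \<in> G"
  shows "card {s. 0 \<le> s \<and> s < 1 \<and> q + s *\<^sub>R e \<in> G} = lattice_length G e"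
proof -
  have "q + frac (r + t) *\<^sub>R e \<in> G" if "t *\<^sub>R e \<in> G" for t
  proof -
    have "q + frac (r + t) *\<^sub>R e = (q + r *\<^sub>R e) + t *\<^sub>R e - of_int \<lfloor>r + t\<rfloor> *\<^sub>R e"
      by (simp add: frac_def algebra_simps)
    moreover have "\<dots> \<in> G"
      by (intro discrete_subgroup_diff[OF G] discrete_subgroup_add[OF G] discrete_subgroup_scale_int[OF G] q e that)
    ultimately show ?thesis by metis
  qed
  moreover have "frac (s - r) *\<^sub>R e \<in> G" if "q + s *\<^sub>R e \<in> G" for s
  proof -
    have "frac (s - r) *\<^sub>R e = (q + s *\<^sub>R e) - (q + r *\<^sub>R e) - of_int \<lfloor>s - r\<rfloor> *\<^sub>R e"
      by (simp add: frac_def algebra_simps)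
    moreover have "\<dots> \<in> G"
      by (intro discrete_subgroup_diff[OF G] discrete_subgroup_scale_int[OF G] q e that)
    ultimately show ?thesis by metis
  qed
  moreover have "frac (frac (r + t) - r) = t" if "0 \<le> t" "t < 1" for t
  proof -
    have "frac (r + t) - r - t = of_int (- \<lfloor>r + t\<rfloor>)" by (simp add: frac_def)
    then have "frac (r + t) - r - t \<in> \<int>" by (metis Ints_of_int)
    then show ?thesis using that by (simp add: frac_unique_iff)
  qed
  moreover have "frac (r + frac (s - r)) = s" if "0 \<le> s" "s < 1" for s
  proof -
    have "r + frac (s - r) - s = of_int (- \<lfloor>s - r\<rfloor>)" by (simp add: frac_def)
    then have "r + frac (s - r) - s \<in> \<int>" by (metis Ints_of_int)
    then show ?thesis using that by (simp add: frac_unique_iff)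
  qed
  ultimately have "bij_betw (\<lambda>t. frac (r + t)) {s. 0 \<le> s \<and> s < 1 \<and> s *\<^sub>R e \<in> G}
     {s. 0 \<le> s \<and> s < 1 \<and> q + s *\<^sub>R e \<in> G}"
    by (intro bij_betw_byWitness[where f' = "\<lambda>s. frac (s - r)"]) (auto simp: frac_lt_1)
  then show ?thesis unfolding lattice_length_def by (rule bij_betw_same_card[symmetric])
qed

text \<open>A discrete Fubini argument: group the points of \<open>X\<close> in \<open>G\<close> by
  their projection. Each nonempty section of \<open>X\<close> is a half-open copy of
  \<open>e\<close>, so every fibre over a projected lattice point has the same size, wherever the
  section starts.\<close>

lemma card_half_open_slices:
  fixes e :: "'a::euclidean_space"
  assumes G: "discrete_subgroup G" and e: "e \<in> G" "e \<noteq> 0" and X: "bounded X"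
    and slice: "\<And>x. x \<in> X \<Longrightarrow>
      \<exists>q. proj_along e q = proj_along e x \<and> (\<forall>s. q + s *\<^sub>R e \<in> X \<longleftrightarrow> 0 \<le> s \<and> s < 1)"
  shows "card (X \<inter> G) = lattice_length G e * card (proj_along e ` X \<inter> proj_along e ` G)"
proof -
  let ?Y = "proj_along e ` X \<inter> proj_along e ` G"
  have fin: "finite (X \<inter> G)" by (rule discrete_subgroup_finite_bounded[OF G X])
  have "finite (proj_along e ` X \<inter> proj_along e ` G)"
    by (intro discrete_subgroup_finite_bounded discrete_subgroup_proj_along G e)
      (rule bounded_linear_image[OF X linear_conv_bounded_linear[THEN iffD1, OF linear_proj_along]])
  moreover have "card {x \<in> X \<inter> G. proj_along e x = y} = lattice_length G e" if "y \<in> ?Y" for y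
  proof -
    obtain x p where x: "x \<in> X" "y = proj_along e x" and p: "p \<in> G" "y = proj_along e p"
      using \<open>y \<in> ?Y\<close> by auto
    obtain q where q: "proj_along e q = y" "\<And>s. q + s *\<^sub>R e \<in> X \<longleftrightarrow> 0 \<le> s \<and> s < 1"
      using slice[OF x(1)] x(2) by auto
    \<comment> \<open>\<open>p\<close> need not lie in \<open>X\<close>; it only witnesses that the
      line of the section carries points of \<open>G\<close>.\<close>
    obtain r where r: "p = q + r *\<^sub>R e" using p(2) q(1) proj_along_eqD[of e q p] by metis
    have "{x \<in> X \<inter> G. proj_along e x = y} = (\<lambda>s. q + s *\<^sub>R e) ` {s. 0 \<le> s \<and> s < 1 \<and> q + s *\<^sub>R e \<in> G}"
    proof (intro equalityI subsetI)
      fix x assume "x \<in> {x \<in> X \<inter> G. proj_along e x = y}"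
      then have x: "x \<in> X" "x \<in> G" "proj_along e q = proj_along e x" using q(1) by auto
      obtain s where "x = q + s *\<^sub>R e" using x(3) by (rule proj_along_eqD)
      with x(1,2) show "x \<in> (\<lambda>s. q + s *\<^sub>R e) ` {s. 0 \<le> s \<and> s < 1 \<and> q + s *\<^sub>R e \<in> G}" using q(2) by auto
    next
      fix x assume "x \<in> (\<lambda>s. q + s *\<^sub>R e) ` {s. 0 \<le> s \<and> s < 1 \<and> q + s *\<^sub>R e \<in> G}"
      then obtain s where s: "x = q + s *\<^sub>R e" "0 \<le> s" "s < 1" "x \<in> G" by blast
      have "proj_along e x = y" unfolding s(1) proj_along_add_scale by (rule q(1))
      moreover have "x \<in> X" unfolding s(1) q(2) using s by simp
      ultimately show "x \<in> {x \<in> X \<inter> G. proj_along e x = y}" using s(4) by simp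
    qed
    moreover have "inj_on (\<lambda>s. q + s *\<^sub>R e) S" for S using e(2) by (auto simp: inj_on_def)
    ultimately show ?thesis
      using card_translated_segment[OF G e(1) p(1)[unfolded r]] by (simp add: card_image)
  qed
  moreover have "card (X \<inter> G) = (\<Sum>y\<in>?Y. card {x \<in> X \<inter> G. proj_along e x = y})"
    using sum.group[OF fin \<open>finite ?Y\<close>, of "proj_along e" "\<lambda>_. 1::nat"] by (simp add: image_subset_iff)
  ultimately show ?thesis by simp
qed

subsection \<open>Zonotopes and half-open parallelepipeds\<close>

definition zono :: "('i \<Rightarrow> 'a::real_vector) \<Rightarrow> 'i set \<Rightarrow> 'a set" where
  "zono v A = (\<lambda>c. \<Sum>i\<in>A. c i *\<^sub>R v i) ` {c. \<forall>i\<in>A. 0 \<le> c i \<and> c i \<le> 1}"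

definition half_open_box :: "('i \<Rightarrow> 'a::real_vector) \<Rightarrow> 'i set \<Rightarrow> 'a set" where
  "half_open_box v A = (\<lambda>c. \<Sum>i\<in>A. c i *\<^sub>R v i) ` {c. \<forall>i\<in>A. 0 \<le> c i \<and> c i < 1}"

text \<open>Independence of a family rather than of a set: a repeated vector counts as a dependence.
  This matters because distinct vectors may coincide after a projection.\<close>

definition lin_indep_family :: "('i \<Rightarrow> 'a::real_vector) \<Rightarrow> 'i set \<Rightarrow> bool" where
  "lin_indep_family v A \<longleftrightarrow> (\<forall>c. (\<Sum>i\<in>A. c i *\<^sub>R v i) = 0 \<longrightarrow> (\<forall>i\<in>A. c i = 0))"

lemma lin_indep_family_unique:
  assumes "lin_indep_family v A" "(\<Sum>i\<in>A. c i *\<^sub>R v i) = (\<Sum>i\<in>A. d i *\<^sub>R v i)" "i \<in> A"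
  shows "c i = d i"
proof -
  have "(\<Sum>i\<in>A. (c i - d i) *\<^sub>R v i) = 0"
    using assms(2) by (simp add: scaleR_left_diff_distrib sum_subtractf)
  then show ?thesis using assms(1,3) unfolding lin_indep_family_def by fastforce
qed

lemma lin_indep_family_iff:
  assumes "finite A"
  shows "lin_indep_family v A \<longleftrightarrow> inj_on v A \<and> independent (v ` A)"
proof (intro iffI conjI)
  assume L: "lin_indep_family v A"
  show inj: "inj_on v A"
  proof (rule inj_onI, rule ccontr)
    fix i j assume ij: "i \<in> A" "j \<in> A" "v i = v j" "i \<noteq> j"
    \<comment> \<open>If two positions carry the same vector, their unit coefficient functions give
      equal sums, against uniqueness of coefficients.\<close>
    have unit: "(\<Sum>k\<in>A. (if k = l then 1 else 0::real) *\<^sub>R v k) = v l" if "l \<in> A" for l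
      using assms that by (subst sum.remove[of _ l]) (auto intro!: sum.neutral)
    have "(\<Sum>k\<in>A. (if k = i then 1 else 0::real) *\<^sub>R v k) = (\<Sum>k\<in>A. (if k = j then 1 else 0) *\<^sub>R v k)"
      unfolding unit[OF ij(1)] unit[OF ij(2)] by (rule ij(3))
    from lin_indep_family_unique[OF L this ij(1)] show False using ij(4) by simp
  qed
  show "independent (v ` A)"
    unfolding real_vector.dependent_finite[OF finite_imageI[OF assms]]
  proof clarify
    fix c i assume "(\<Sum>b\<in>v ` A. c b *\<^sub>R b) = 0" and i: "i \<in> A" "c (v i) \<noteq> 0"
    then have "(\<Sum>j\<in>A. c (v j) *\<^sub>R v j) = 0" using inj by (simp add: sum.reindex)
    from L[unfolded lin_indep_family_def, rule_format, OF this i(1)] i(2) show False by simp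
  qed
next
  assume "inj_on v A \<and> independent (v ` A)"
  then have inj: "inj_on v A" and indep: "independent (v ` A)" by auto
  show "lin_indep_family v A" unfolding lin_indep_family_def
  proof (intro allI impI ballI)
    fix c i assume c: "(\<Sum>i\<in>A. c i *\<^sub>R v i) = 0" and i: "i \<in> A"
    have "(\<Sum>b\<in>v ` A. c (the_inv_into A v b) *\<^sub>R b) = 0"
      using c by (simp only: sum.reindex[OF inj] comp_def) (simp add: the_inv_into_f_f[OF inj] cong: sum.cong)
    from real_vector.independentD[OF indep finite_imageI[OF assms] order_refl this imageI[OF i]]
    have "c (the_inv_into A v (v i)) = 0" .
    then show "c i = 0" unfolding the_inv_into_f_f[OF inj i] .
  qed
qed

text \<open>Independence under contraction: a relation among the projections lifts to one among the
  vectors with an extra multiple of \<open>v i\<close>, and conversely a relation projects to one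
  without that term, whose coefficient then vanishes because \<open>v i\<close> is nonzero.\<close>

lemma lin_indep_family_insert:
  assumes A: "finite A" and i: "i \<notin> A" and nz: "v i \<noteq> 0"
  shows "lin_indep_family v (insert i A) \<longleftrightarrow> lin_indep_family (\<lambda>j. proj_along (v i) (v j)) A"
proof
  have proj: "(\<Sum>j\<in>A. c j *\<^sub>R proj_along (v i) (v j)) = proj_along (v i) (\<Sum>j\<in>A. c j *\<^sub>R v j)" for c
    by (simp add: linear_sum[OF linear_proj_along] linear_scale[OF linear_proj_along])
  {
    assume L: "lin_indep_family v (insert i A)"
    show "lin_indep_family (\<lambda>j. proj_along (v i) (v j)) A"
      unfolding lin_indep_family_def
    proof (intro allI impI ballI)
      fix c j assume c: "(\<Sum>j\<in>A. c j *\<^sub>R proj_along (v i) (v j)) = 0" and j: "j \<in> A"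
      then have "proj_along (v i) (\<Sum>j\<in>A. c j *\<^sub>R v j) = proj_along (v i) 0"
        using proj linear_0[OF linear_proj_along] by metis
      \<comment> \<open>The fibre of the projection over 0 is the line of \<open>v i\<close>, which
        supplies the coefficient at \<open>i\<close>.\<close>
      then obtain s where s: "0 = (\<Sum>j\<in>A. c j *\<^sub>R v j) + s *\<^sub>R v i" by (rule proj_along_eqD)
      have "(\<Sum>j\<in>insert i A. (c(i := s)) j *\<^sub>R v j) = s *\<^sub>R v i + (\<Sum>j\<in>A. c j *\<^sub>R v j)"
        using A i by (simp, intro sum.cong) auto
      then have "(c(i := s)) j = 0" using s L j unfolding lin_indep_family_def by (metis add.commute insertCI)
      then show "c j = 0" using i j by (auto split: if_splits)
    qed
  }
  assume R: "lin_indep_family (\<lambda>j. proj_along (v i) (v j)) A"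
  show "lin_indep_family v (insert i A)"
    unfolding lin_indep_family_def
  proof (intro allI impI)
    fix c assume c: "(\<Sum>j\<in>insert i A. c j *\<^sub>R v j) = 0"
    then have c0: "(\<Sum>j\<in>A. c j *\<^sub>R v j) + c i *\<^sub>R v i = 0" using A i by (simp add: add.commute)
    then have "proj_along (v i) (\<Sum>j\<in>A. c j *\<^sub>R v j) = 0"
      using proj_along_add_scale linear_0[OF linear_proj_along] by metis
    then have *: "\<forall>j\<in>A. c j = 0" using R proj unfolding lin_indep_family_def by metis
    then have "c i = 0" using c0 nz by simp
    then show "\<forall>j\<in>insert i A. c j = 0" using * by simp
  qed
qed

lemma zono_insert:
  assumes "finite A" "i \<notin> A"
  shows "zono v (insert i A) = {z + s *\<^sub>R v i | z s. z \<in> zono v A \<and> 0 \<le> s \<and> s \<le> 1}"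
proof (intro equalityI subsetI)
  fix x assume "x \<in> zono v (insert i A)"
  then obtain c where "x = (\<Sum>j\<in>A. c j *\<^sub>R v j) + c i *\<^sub>R v i" "\<forall>j\<in>insert i A. 0 \<le> c j \<and> c j \<le> 1"
    using assms by (auto simp: zono_def add.commute)
  then show "x \<in> {z + s *\<^sub>R v i | z s. z \<in> zono v A \<and> 0 \<le> s \<and> s \<le> 1}" unfolding zono_def by blast
next
  fix x assume "x \<in> {z + s *\<^sub>R v i | z s. z \<in> zono v A \<and> 0 \<le> s \<and> s \<le> 1}"
  then obtain c s where c: "x = (\<Sum>j\<in>A. c j *\<^sub>R v j) + s *\<^sub>R v i" "\<forall>j\<in>A. 0 \<le> c j \<and> c j \<le> 1" "0 \<le> s" "s \<le> 1"
    unfolding zono_def by blast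
  then have "x = (\<Sum>j\<in>insert i A. (c(i := s)) j *\<^sub>R v j)"
    using assms by (simp add: add.commute, intro sum.cong) auto
  then show "x \<in> zono v (insert i A)" unfolding zono_def using c assms by (intro image_eqI[of _ _ "c(i := s)"]) auto
qed

lemma half_open_box_insert:
  assumes "finite A" "i \<notin> A"
  shows "half_open_box v (insert i A) = {z + s *\<^sub>R v i | z s. z \<in> half_open_box v A \<and> 0 \<le> s \<and> s < 1}"
proof (intro equalityI subsetI)
  fix x assume "x \<in> half_open_box v (insert i A)"
  then obtain c where "x = (\<Sum>j\<in>A. c j *\<^sub>R v j) + c i *\<^sub>R v i" "\<forall>j\<in>insert i A. 0 \<le> c j \<and> c j < 1"
    using assms by (auto simp: half_open_box_def add.commute)
  then show "x \<in> {z + s *\<^sub>R v i | z s. z \<in> half_open_box v A \<and> 0 \<le> s \<and> s < 1}"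
    unfolding half_open_box_def by blast
next
  fix x assume "x \<in> {z + s *\<^sub>R v i | z s. z \<in> half_open_box v A \<and> 0 \<le> s \<and> s < 1}"
  then obtain c s where c: "x = (\<Sum>j\<in>A. c j *\<^sub>R v j) + s *\<^sub>R v i" "\<forall>j\<in>A. 0 \<le> c j \<and> c j < 1" "0 \<le> s" "s < 1"
    unfolding half_open_box_def by blast
  then have "x = (\<Sum>j\<in>insert i A. (c(i := s)) j *\<^sub>R v j)"
    using assms by (simp add: add.commute, intro sum.cong) auto
  then show "x \<in> half_open_box v (insert i A)"
    unfolding half_open_box_def using c assms by (intro image_eqI[of _ _ "c(i := s)"]) auto
qed

text \<open>Compactness bounds the point counts and provides a lowest point on each line section;
  the induction writes the zonotope as a continuous image of a product with an interval.\<close>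

lemma compact_zono:
  fixes v :: "'i \<Rightarrow> 'a::real_normed_vector"
  assumes "finite A"
  shows "compact (zono v A)"
  using assms
proof induction
  case empty
  then show ?case by (simp add: zono_def)
next
  case (insert i A)
  have "zono v (insert i A) = (\<lambda>(z, s). z + s *\<^sub>R v i) ` (zono v A \<times> {0..1})"
    unfolding zono_insert[OF insert(1,2)] by (auto simp: image_iff) (metis atLeastAtMost_iff)+
  moreover have "compact \<dots>"
    by (intro compact_continuous_image compact_Times insert.IH compact_Icc)
      (auto simp: split_def intro!: continuous_intros)
  ultimately show ?case by simp
qed

text \<open>Convexity makes every line section an interval, which \<open>card_zono_insert\<close>
  relies on.\<close>

lemma convex_zono: "convex (zono v A)"
  unfolding convex_alt
proof (intro ballI allI impI)
  fix x y and u :: real assume xy: "x \<in> zono v A" "y \<in> zono v A" and u: "0 \<le> u \<and> u \<le> 1"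
  obtain c d where x: "x = (\<Sum>i\<in>A. c i *\<^sub>R v i)" "\<forall>i\<in>A. 0 \<le> c i \<and> c i \<le> 1"
    and y: "y = (\<Sum>i\<in>A. d i *\<^sub>R v i)" "\<forall>i\<in>A. 0 \<le> d i \<and> d i \<le> 1"
    using xy unfolding zono_def by blast
  have "(1 - u) *\<^sub>R x + u *\<^sub>R y = (\<Sum>i\<in>A. ((1 - u) * c i + u * d i) *\<^sub>R v i)"
    by (simp add: x y scaleR_sum_right scaleR_left_distrib sum.distrib)
  moreover have "0 \<le> (1 - u) * c i + u * d i \<and> (1 - u) * c i + u * d i \<le> 1" if "i \<in> A" for i
    using x y u that convex_bound_le[of "c i" 1 "d i" "1 - u" u] by auto
  ultimately show "(1 - u) *\<^sub>R x + u *\<^sub>R y \<in> zono v A"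
    unfolding zono_def by (intro image_eqI[of _ _ "\<lambda>i. (1 - u) * c i + u * d i"]) auto
qed

lemma linear_image_zono:
  assumes "linear f"
  shows "f ` zono v A = zono (\<lambda>i. f (v i)) A"
  unfolding zono_def image_image by (simp add: linear_sum[OF assms] linear_scale[OF assms])

lemma linear_image_half_open_box:
  assumes "linear f"
  shows "f ` half_open_box v A = half_open_box (\<lambda>i. f (v i)) A"
  unfolding half_open_box_def image_image by (simp add: linear_sum[OF assms] linear_scale[OF assms])

lemma half_open_box_subset_zono: "half_open_box v A \<subseteq> zono v A"
  unfolding half_open_box_def zono_def by (rule image_mono) (auto simp: less_imp_le)

lemma bounded_half_open_box:
  fixes v :: "'i \<Rightarrow> 'a::real_normed_vector"
  shows "finite A \<Longrightarrow> bounded (half_open_box v A)"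
  by (rule bounded_subset[OF compact_imp_bounded[OF compact_zono] half_open_box_subset_zono])

section \<open>Deletion and contraction for lattice point counts\<close>

text \<open>By independence a line parallel to \<open>v i\<close> meets the box in one half-open
  copy of \<open>v i\<close>, starting where the coefficient of \<open>i\<close> is 0. The slicing
  lemma applies, and projecting simply drops the generator \<open>v i\<close>.\<close>

lemma card_half_open_box_insert:
  fixes v :: "'i \<Rightarrow> 'a::euclidean_space"
  assumes G: "discrete_subgroup G" and A: "finite A" "i \<notin> A" and i: "v i \<in> G"
    and indep: "lin_indep_family v (insert i A)" and nz: "v i \<noteq> 0"
  shows "card (half_open_box v (insert i A) \<inter> G) = lattice_length G (v i) *
           card (half_open_box (\<lambda>j. proj_along (v i) (v j)) A \<inter> proj_along (v i) ` G)"
proof -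
  let ?X = "half_open_box v (insert i A)"
  have "\<exists>q. proj_along (v i) q = proj_along (v i) x \<and> (\<forall>s. q + s *\<^sub>R v i \<in> ?X \<longleftrightarrow> 0 \<le> s \<and> s < 1)"
    if x: "x \<in> ?X" for x
  proof -
    obtain q r where q: "x = q + r *\<^sub>R v i" "q \<in> half_open_box v A" "0 \<le> r" "r < 1"
      using x unfolding half_open_box_insert[OF A] by blast
    have "0 \<le> s \<and> s < 1" if s: "q + s *\<^sub>R v i \<in> ?X" for s
    proof -
      obtain c where c: "q = (\<Sum>j\<in>A. c j *\<^sub>R v j)" using q unfolding half_open_box_def by blast
      obtain d where d: "q + s *\<^sub>R v i = (\<Sum>j\<in>insert i A. d j *\<^sub>R v j)" "0 \<le> d i \<and> d i < 1"
        using s unfolding half_open_box_def by blast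
      \<comment> \<open>Two representations of one point agree at \<open>i\<close>, which identifies
        \<open>s\<close> with the coefficient \<open>d i\<close> in [0, 1).\<close>
      have "(\<Sum>j\<in>insert i A. (c(i := s)) j *\<^sub>R v j) = s *\<^sub>R v i + q"
        using A unfolding c by (simp, intro sum.cong) auto
      then have "(c(i := s)) i = d i"
        using d by (intro lin_indep_family_unique[OF indep]) (simp_all add: add.commute)
      then show ?thesis using d by simp
    qed
    moreover have "q + s *\<^sub>R v i \<in> ?X" if "0 \<le> s \<and> s < 1" for s
      using q(2) that unfolding half_open_box_insert[OF A] by blast
    moreover have "proj_along (v i) q = proj_along (v i) x"
      unfolding q(1) proj_along_add_scale ..
    ultimately show ?thesis by blast
  qed
  then have "card (?X \<inter> G) = lattice_length G (v i) * card (proj_along (v i) ` ?X \<inter> proj_along (v i) ` G)"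
    using bounded_half_open_box[of "insert i A" v] A by (intro card_half_open_slices G i nz) auto
  moreover have "proj_along (v i) ` ?X = proj_along (v i) ` half_open_box v A"
  proof (intro equalityI subsetI)
    fix y assume "y \<in> proj_along (v i) ` ?X"
    then show "y \<in> proj_along (v i) ` half_open_box v A"
      unfolding half_open_box_insert[OF A] by (auto simp: proj_along_add_scale)
  next
    have "half_open_box v A \<subseteq> ?X"
      unfolding half_open_box_insert[OF A]
      by clarsimp (metis add.right_neutral order_refl scaleR_zero_left zero_less_one)
    then show "y \<in> proj_along (v i) ` ?X" if "y \<in> proj_along (v i) ` half_open_box v A" for y
      using that by blast
  qed
  ultimately show ?thesis by (simp add: linear_image_half_open_box[OF linear_proj_along])
qed

text \<open>A section of \<open>zono v A\<close> parallel to \<open>v i\<close> is a compact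
  segment, and inserting \<open>i\<close> prolongs it by \<open>v i\<close>. The added part has
  half-open sections even when the family is dependent, so the slicing lemma counts it.\<close>

lemma card_zono_insert:
  fixes v :: "'i \<Rightarrow> 'a::euclidean_space"
  assumes G: "discrete_subgroup G" and A: "finite A" "i \<notin> A" and i: "v i \<in> G" and nz: "v i \<noteq> 0"
  shows "card (zono v (insert i A) \<inter> G) = card (zono v A \<inter> G) + lattice_length G (v i) *
           card (zono (\<lambda>j. proj_along (v i) (v j)) A \<inter> proj_along (v i) ` G)"
proof -
  define e where "e = v i"
  define Z where "Z = zono v A"
  define ZI where "ZI = zono v (insert i A)"
  \<comment> \<open>Removing the translate \<open>Z + e\<close> rather than \<open>Z\<close> leaves sections that contain their lower endpoint.\<close>
  define T where "T = (\<lambda>z. z + e) ` Z"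
  define X where "X = ZI - T"
  have ZI: "ZI = {z + s *\<^sub>R e | z s. z \<in> Z \<and> 0 \<le> s \<and> s \<le> 1}"
    unfolding ZI_def Z_def e_def by (rule zono_insert[OF A])
  have Z: "compact Z" "convex Z" unfolding Z_def by (auto intro: compact_zono convex_zono A)
  have e: "e \<in> G" "e \<noteq> 0" using i nz e_def by auto
  have slice: "\<exists>q. proj_along e q = proj_along e z \<and> (\<forall>s. q + s *\<^sub>R e \<in> X \<longleftrightarrow> 0 \<le> s \<and> s < 1)"
    if "z \<in> Z" for z
  proof -
    let ?C = "Z \<inter> {x. proj_along e x = proj_along e z}"
    have "closed {x. proj_along e x = proj_along e z}"
      unfolding proj_along_def by (intro closed_Collect_eq continuous_intros) (use e in auto)
    then have "compact ?C" using Z by (intro compact_Int_closed)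
    moreover have "?C \<noteq> {}" using that by auto
    moreover have "continuous_on ?C (\<lambda>x. x \<bullet> e)" by (intro continuous_intros)
    \<comment> \<open>\<open>q\<close> is the lowest point of \<open>Z\<close> on the line through
      \<open>z\<close>; the half-open section of \<open>X\<close> will start there.\<close>
    ultimately obtain q where q: "q \<in> ?C" "\<And>x. x \<in> ?C \<Longrightarrow> q \<bullet> e \<le> x \<bullet> e"
      using continuous_attains_inf by metis
    have low: "0 \<le> s" if "q + s *\<^sub>R e \<in> Z" for s
    proof -
      have "q + s *\<^sub>R e \<in> ?C" using that q(1) by (simp add: proj_along_add_scale)
      then have "0 \<le> s * (e \<bullet> e)" using q(2) by (fastforce simp: inner_add_left)
      then show ?thesis using e by (metis inner_gt_zero_iff mult_le_cancel_right_pos mult_zero_left)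
    qed
    have "q + s *\<^sub>R e \<in> X" if s: "0 \<le> s" "s < 1" for s
    proof -
      have "q + s *\<^sub>R e \<notin> T"
      proof
        assume "q + s *\<^sub>R e \<in> T"
        then have "q + (s - 1) *\<^sub>R e \<in> Z" unfolding T_def by (auto simp: algebra_simps)
        then show False using low s by force
      qed
      moreover have "q + s *\<^sub>R e \<in> ZI" using q(1) s unfolding ZI by force
      ultimately show ?thesis unfolding X_def by simp
    qed
    moreover have "0 \<le> s \<and> s < 1" if s: "q + s *\<^sub>R e \<in> X" for s
    proof -
      obtain x u where x: "q + s *\<^sub>R e = x + u *\<^sub>R e" "x \<in> Z" "0 \<le> u" "u \<le> 1"
        using s unfolding X_def ZI by auto
      then have x': "x = q + (s - u) *\<^sub>R e" by (simp add: algebra_simps)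
      then have su: "0 \<le> s - u" using low x(2) by metis
      have "s < 1"
      proof (rule ccontr)
        assume s1: "\<not> s < 1"
        have "q + (s - 1) *\<^sub>R e \<in> Z"
        proof (cases "s = u")
          case True
          then have "s = 1" using s1 x by simp
          then show ?thesis using q by simp
        next
          case False
          \<comment> \<open>If \<open>s\<close> were at least 1, the point with parameter
            \<open>s - 1\<close> would lie between \<open>q\<close> and \<open>x\<close> on the
            line, with weight \<open>w\<close> on \<open>x\<close>. By convexity it would belong to
            \<open>Z\<close>, hence its translate by \<open>e\<close> to \<open>T\<close>.\<close>
          define w where "w = (s - 1) / (s - u)"
          have w: "0 \<le> w" "w \<le> 1" "w * (s - u) = s - 1" unfolding w_def using False su s1 x by auto
          have "(1 - w) *\<^sub>R q + w *\<^sub>R x \<in> Z" using Z(2) q(1) x(2) w unfolding convex_alt by auto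
          moreover have "(1 - w) *\<^sub>R q + w *\<^sub>R x = q + (w * (s - u)) *\<^sub>R e"
            unfolding x' by (simp add: algebra_simps)
          ultimately show ?thesis using w by simp
        qed
        then have "q + s *\<^sub>R e \<in> T" unfolding T_def
          by (intro image_eqI[of _ _ "q + (s - 1) *\<^sub>R e"]) (auto simp: algebra_simps)
        then show False using s X_def by simp
      qed
      then show ?thesis using su x by simp
    qed
    ultimately show ?thesis using q(1) by auto
  qed
  have bdd: "bounded ZI" unfolding ZI_def using A by (simp add: compact_imp_bounded compact_zono)
  have "card (X \<inter> G) = lattice_length G e * card (proj_along e ` X \<inter> proj_along e ` G)"
  proof (rule card_half_open_slices[OF G e])
    show "bounded X" using bdd X_def bounded_subset by blast
    fix x assume "x \<in> X"
    then obtain z s where "x = z + s *\<^sub>R e" "z \<in> Z" unfolding X_def ZI by auto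
    then show "\<exists>q. proj_along e q = proj_along e x \<and> (\<forall>s. q + s *\<^sub>R e \<in> X \<longleftrightarrow> 0 \<le> s \<and> s < 1)"
      using slice[of z] proj_along_add_scale[of e z s] by simp
  qed
  moreover have "proj_along e ` X = proj_along e ` Z"
  proof (intro equalityI subsetI)
    fix y assume "y \<in> proj_along e ` X"
    then show "y \<in> proj_along e ` Z" unfolding X_def ZI by (auto simp: proj_along_add_scale)
  next
    fix y assume "y \<in> proj_along e ` Z"
    then obtain z where z: "z \<in> Z" "y = proj_along e z" by auto
    obtain q where q: "proj_along e q = y" "\<forall>s. q + s *\<^sub>R e \<in> X \<longleftrightarrow> 0 \<le> s \<and> s < 1"
      using slice[OF z(1)] z(2) by blast
    then have "q \<in> X" using q(2)[rule_format, of 0] by simp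
    then show "y \<in> proj_along e ` X" using q(1) by blast
  qed
  moreover have "card (ZI \<inter> G) = card (T \<inter> G) + card (X \<inter> G)"
  proof -
    have "T \<subseteq> ZI" unfolding T_def ZI by clarsimp (metis order_refl scaleR_one zero_le_one)
    then have "ZI \<inter> G = (T \<inter> G) \<union> (X \<inter> G)" "(T \<inter> G) \<inter> (X \<inter> G) = {}" unfolding X_def by auto
    moreover have "finite (ZI \<inter> G)" by (rule discrete_subgroup_finite_bounded[OF G bdd])
    ultimately show ?thesis by (metis card_Un_disjoint finite_Un)
  qed
  \<comment> \<open>Since \<open>e\<close> lies in \<open>G\<close>, translation by \<open>e\<close>
    preserves \<open>G\<close>, so removing \<open>T\<close> costs as many lattice points as
    removing \<open>Z\<close>.\<close>
  moreover have "card (T \<inter> G) = card (Z \<inter> G)"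
  proof -
    have "T \<inter> G = (\<lambda>z. z + e) ` (Z \<inter> G)"
    proof (intro equalityI subsetI)
      fix x assume "x \<in> T \<inter> G"
      then obtain z where z: "x = z + e" "z \<in> Z" "x \<in> G" unfolding T_def by auto
      then have "z \<in> G" using discrete_subgroup_diff[OF G z(3) e(1)] by simp
      then show "x \<in> (\<lambda>z. z + e) ` (Z \<inter> G)" using z by auto
    qed (auto simp: T_def discrete_subgroup_add[OF G] e)
    then show ?thesis by (simp add: card_image)
  qed
  ultimately have "card (ZI \<inter> G) = card (Z \<inter> G) + lattice_length G e * card (proj_along e ` Z \<inter> proj_along e ` G)"
    by simp
  moreover have "proj_along e ` Z = zono (\<lambda>j. proj_along e (v j)) A"
    unfolding Z_def by (rule linear_image_zono[OF linear_proj_along])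
  ultimately show ?thesis
    unfolding Z_def ZI_def by (simp only: e_def)
qed

text \<open>Independent sets without \<open>i\<close> come from the deletion, and those with
  \<open>i\<close> correspond to independent sets of the contraction. The induction leaves
  \<open>G\<close> and \<open>v\<close> arbitrary because contraction replaces both.\<close>

lemma card_zono_eq_sum_half_open_boxes:
  fixes v :: "'i \<Rightarrow> 'a::euclidean_space"
  assumes "finite A" "discrete_subgroup G" "v ` A \<subseteq> G"
  shows "card (zono v A \<inter> G) = (\<Sum>B | B \<subseteq> A \<and> lin_indep_family v B. card (half_open_box v B \<inter> G))"
  using assms
proof (induction A arbitrary: G v)
  case empty
  have "{B. B \<subseteq> {} \<and> lin_indep_family v B} = {{}}" by (auto simp: lin_indep_family_def)
  then show ?case by (simp add: zono_def half_open_box_def)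
next
  case (insert i A)
  let ?S = "\<lambda>v A. {B. B \<subseteq> A \<and> lin_indep_family v B}"
  have IH: "card (zono v A \<inter> G) = (\<Sum>B\<in>?S v A. card (half_open_box v B \<inter> G))"
    using insert.IH insert.prems by auto
  show ?case
  proof (cases "v i = 0")
    \<comment> \<open>A zero vector is a loop: it does not enlarge the zonotope and belongs to no
      independent subfamily.\<close>
    case True
    have "zono v (insert i A) = zono v A"
      unfolding zono_insert[OF insert.hyps] using True by (auto intro: exI[of _ 0])
    moreover have "?S v (insert i A) = ?S v A"
    proof -
      have "i \<notin> B" if B: "B \<subseteq> insert i A" "lin_indep_family v B" for B
      proof
        assume "i \<in> B"
        have "(\<Sum>j\<in>B. (if j = i then 1 else 0) *\<^sub>R v j) = 0"
          using True by (intro sum.neutral) auto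
        then show False using B(2) \<open>i \<in> B\<close> unfolding lin_indep_family_def by fastforce
      qed
      then show ?thesis by blast
    qed
    ultimately show ?thesis using IH by simp
  next
    case False
    let ?pv = "\<lambda>j. proj_along (v i) (v j)" and ?pG = "proj_along (v i) ` G"
    have vi: "v i \<in> G" using insert.prems by auto
    have "card (zono ?pv A \<inter> ?pG) = (\<Sum>B\<in>?S ?pv A. card (half_open_box ?pv B \<inter> ?pG))"
      using insert.prems by (intro insert.IH discrete_subgroup_proj_along) auto
    then have "lattice_length G (v i) * card (zono ?pv A \<inter> ?pG) =
        (\<Sum>B\<in>?S ?pv A. lattice_length G (v i) * card (half_open_box ?pv B \<inter> ?pG))"
      by (simp add: sum_distrib_left)
    also have "\<dots> = (\<Sum>B\<in>?S ?pv A. card (half_open_box v (insert i B) \<inter> G))"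
    proof (intro sum.cong refl)
      fix B assume "B \<in> ?S ?pv A"
      moreover from this have "finite B" "i \<notin> B" using insert.hyps finite_subset by auto
      ultimately show "lattice_length G (v i) * card (half_open_box ?pv B \<inter> ?pG)
          = card (half_open_box v (insert i B) \<inter> G)"
        using card_half_open_box_insert[of G B i v] insert.prems(1) vi
          lin_indep_family_insert[of B i v] False by simp
    qed
    also have "\<dots> = (\<Sum>B\<in>insert i ` ?S ?pv A. card (half_open_box v B \<inter> G))"
      using insert.hyps by (subst sum.reindex) (auto simp: inj_on_def)
    finally have "card (zono v (insert i A) \<inter> G) = (\<Sum>B\<in>?S v A. card (half_open_box v B \<inter> G))
         + (\<Sum>B\<in>insert i ` ?S ?pv A. card (half_open_box v B \<inter> G))"
      using card_zono_insert[of G A i v] insert.prems(1) insert.hyps vi False IH by simp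
    also have "\<dots> = (\<Sum>B\<in>?S v A \<union> insert i ` ?S ?pv A. card (half_open_box v B \<inter> G))"
      using insert.hyps by (intro sum.union_disjoint[symmetric]) auto
    also have "?S v A \<union> insert i ` ?S ?pv A = ?S v (insert i A)"
    proof -
      have ins: "lin_indep_family v (insert i B) \<longleftrightarrow> lin_indep_family ?pv B" if "B \<subseteq> A" for B
        using that insert.hyps False finite_subset by (intro lin_indep_family_insert) auto
      have "B \<in> insert i ` ?S ?pv A" if "B \<subseteq> insert i A" "lin_indep_family v B" "i \<in> B" for B
        using that ins[of "B - {i}"] by (intro image_eqI[of _ _ "B - {i}"]) (auto simp: insert_absorb)
      then show ?thesis using ins by auto
    qed
    finally show ?thesis .
  qed
qed

section \<open>Dilation by a positive integer\<close>

text \<open>The half-open segment from 0 to \<open>real k *\<^sub>R e\<close> consists of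
  \<open>k\<close> translates of the one from 0 to \<open>e\<close> by multiples of
  \<open>e\<close>, all of which lie in \<open>G\<close>.\<close>

lemma lattice_length_scale:
  assumes G: "discrete_subgroup G" and e: "e \<in> G" "e \<noteq> 0" and k: "k > 0"
  shows "lattice_length G (real k *\<^sub>R e) = k * lattice_length G e"
proof -
  let ?W = "\<lambda>k. {s. 0 \<le> s \<and> s < real k \<and> s *\<^sub>R e \<in> G}"
  have fin: "finite (?W k)" for k
  proof -
    have "bounded ((\<lambda>s. s *\<^sub>R e) ` {0..real k})"
      by (intro compact_imp_bounded compact_continuous_image continuous_intros compact_Icc)
    then have "finite ((\<lambda>s. s *\<^sub>R e) ` {0..real k} \<inter> G)"
      by (rule discrete_subgroup_finite_bounded[OF G])
    moreover have "(\<lambda>s. s *\<^sub>R e) ` ?W k \<subseteq> (\<lambda>s. s *\<^sub>R e) ` {0..real k} \<inter> G" by auto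
    ultimately have "finite ((\<lambda>s. s *\<^sub>R e) ` ?W k)" using finite_subset by blast
    moreover have "inj_on (\<lambda>s. s *\<^sub>R e) (?W k)" using e by (auto simp: inj_on_def)
    ultimately show ?thesis using finite_imageD by blast
  qed
  have W: "card (?W k) = k * lattice_length G e" for k
  proof (induction k)
    case 0
    have none: "?W 0 = {}" by auto
    show ?case unfolding none by simp
  next
    case (Suc k)
    let ?V = "(\<lambda>s. s + real k) ` ?W 1"
    have "?W (Suc k) = ?W k \<union> ?V"
    proof (intro equalityI subsetI)
      fix s assume s: "s \<in> ?W (Suc k)"
      show "s \<in> ?W k \<union> ?V"
      proof (cases "s < real k")
        case False
        have "(s - real k) *\<^sub>R e = s *\<^sub>R e - real k *\<^sub>R e" by (simp add: algebra_simps)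
        then have "(s - real k) *\<^sub>R e \<in> G"
          using s discrete_subgroup_diff[OF G _ discrete_subgroup_scale_nat[OF G e(1)]] by simp
        then have "s \<in> ?V" using s False by (intro image_eqI[of _ _ "s - real k"]) auto
        then show ?thesis by simp
      qed (use s in auto)
    next
      fix s assume "s \<in> ?W k \<union> ?V"
      then show "s \<in> ?W (Suc k)"
        using discrete_subgroup_add[OF G _ discrete_subgroup_scale_nat[OF G e(1)]]
        by (auto simp: scaleR_left_distrib)
    qed
    moreover have "?W k \<inter> ?V = {}" by auto
    ultimately have "card (?W (Suc k)) = card (?W k) + card ?V"
      using fin[of k] fin[of 1] by (simp add: card_Un_disjoint)
    moreover have "card ?V = lattice_length G e"
      unfolding lattice_length_def by (subst card_image) auto
    ultimately show ?case using Suc by simp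
  qed
  \<comment> \<open>Rescaling the parameter trades the dilated vector for a window of length
    \<open>k\<close>.\<close>
  have "bij_betw (\<lambda>s. s * real k) {s. 0 \<le> s \<and> s < 1 \<and> s *\<^sub>R (real k *\<^sub>R e) \<in> G} (?W k)"
    using k by (intro bij_betw_byWitness[where f' = "\<lambda>s. s / real k"]) (auto simp: divide_simps)
  then have "card {s. 0 \<le> s \<and> s < 1 \<and> s *\<^sub>R (real k *\<^sub>R e) \<in> G} = card (?W k)"
    by (rule bij_betw_same_card)
  then show ?thesis using W[of k] unfolding lattice_length_def by simp
qed

lemma lin_indep_family_scale:
  assumes "k \<noteq> 0"
  shows "lin_indep_family (\<lambda>i. k *\<^sub>R v i) A \<longleftrightarrow> lin_indep_family v A"
proof
  assume L: "lin_indep_family (\<lambda>i. k *\<^sub>R v i) A"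
  show "lin_indep_family v A" unfolding lin_indep_family_def
  proof (intro allI impI)
    fix c assume "(\<Sum>i\<in>A. c i *\<^sub>R v i) = 0"
    then have "(\<Sum>i\<in>A. (c i / k) *\<^sub>R (k *\<^sub>R v i)) = 0" using assms by simp
    from L[unfolded lin_indep_family_def, rule_format, OF this] show "\<forall>i\<in>A. c i = 0" using assms by simp
  qed
next
  assume L: "lin_indep_family v A"
  show "lin_indep_family (\<lambda>i. k *\<^sub>R v i) A" unfolding lin_indep_family_def
  proof (intro allI impI)
    fix c assume "(\<Sum>i\<in>A. c i *\<^sub>R (k *\<^sub>R v i)) = 0"
    then have "(\<Sum>i\<in>A. (c i * k) *\<^sub>R v i) = 0" by simp
    from L[unfolded lin_indep_family_def, rule_format, OF this] show "\<forall>i\<in>A. c i = 0" using assms by simp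
  qed
qed

text \<open>Each contraction contributes one factor \<open>k\<close> through the lattice length.
  Projecting along the dilated vector is the same as projecting along the original one, so the
  projected group is unchanged and the induction continues.\<close>

lemma card_half_open_box_scale:
  fixes v :: "'i \<Rightarrow> 'a::euclidean_space"
  assumes "finite B" "discrete_subgroup G" "v ` B \<subseteq> G" "lin_indep_family v B" "k > 0"
  shows "card (half_open_box (\<lambda>i. real k *\<^sub>R v i) B \<inter> G) = k ^ card B * card (half_open_box v B \<inter> G)"
  using assms
proof (induction B arbitrary: G v)
  case empty
  then show ?case by (simp add: half_open_box_def)
next
  case (insert i B)
  let ?kv = "\<lambda>i. real k *\<^sub>R v i"
  have nz: "v i \<noteq> 0"
  proof
    assume "v i = 0"
    then have "(\<Sum>j\<in>insert i B. (if j = i then 1 else 0) *\<^sub>R v j) = 0"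
      by (intro sum.neutral) auto
    then show False using insert.prems unfolding lin_indep_family_def by fastforce
  qed
  have vi: "v i \<in> G" using insert.prems by auto
  have "?kv i \<in> G" using discrete_subgroup_scale_nat insert.prems vi by blast
  have kn: "real k \<noteq> 0" using insert.prems by simp
  have "card (half_open_box ?kv (insert i B) \<inter> G) = lattice_length G (?kv i) *
     card (half_open_box (\<lambda>j. proj_along (?kv i) (?kv j)) B \<inter> proj_along (?kv i) ` G)"
    using insert nz \<open>?kv i \<in> G\<close> kn by (intro card_half_open_box_insert) (auto simp: lin_indep_family_scale)
  also have "\<dots> = (k * lattice_length G (v i)) *
     card (half_open_box (\<lambda>j. real k *\<^sub>R proj_along (v i) (v j)) B \<inter> proj_along (v i) ` G)"
    using lattice_length_scale[OF insert.prems(1) vi nz insert.prems(4)]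
    by (simp add: proj_along_scale[OF kn] linear_scale[OF linear_proj_along])
  also have "card (half_open_box (\<lambda>j. real k *\<^sub>R proj_along (v i) (v j)) B \<inter> proj_along (v i) ` G)
     = k ^ card B * card (half_open_box (\<lambda>j. proj_along (v i) (v j)) B \<inter> proj_along (v i) ` G)"
    using insert nz by (intro insert.IH discrete_subgroup_proj_along) (auto simp: lin_indep_family_insert)
  finally show ?case
    using card_half_open_box_insert[of G B i v] insert.prems insert.hyps vi nz by simp
qed

subsection \<open>The torsion of the quotient by an independent family\<close>

lemma int_span_image:
  assumes "finite B" "inj_on v B"
  shows "int_span (v ` B) = range (\<lambda>u. \<Sum>i\<in>B. of_int (u i) *\<^sub>R v i)"
  unfolding int_module.span_finite[OF finite_imageI[OF assms(1)]] sum.reindex[OF assms(2)] comp_def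
proof (intro equalityI subsetI)
  fix x assume "x \<in> range (\<lambda>u. \<Sum>i\<in>B. of_int (u (v i)) *\<^sub>R v i)"
  then obtain u where "x = (\<Sum>i\<in>B. of_int (u (v i)) *\<^sub>R v i)" by blast
  then show "x \<in> range (\<lambda>u. \<Sum>i\<in>B. of_int (u i) *\<^sub>R v i)"
    by (intro image_eqI[of _ _ "\<lambda>i. u (v i)"]) auto
next
  fix x assume "x \<in> range (\<lambda>u. \<Sum>i\<in>B. of_int (u i) *\<^sub>R v i)"
  then obtain u where "x = (\<Sum>i\<in>B. of_int (u i) *\<^sub>R v i)" by blast
  then have "x = (\<Sum>i\<in>B. of_int (u (the_inv_into B v (v i))) *\<^sub>R v i)"
    by (simp add: the_inv_into_f_f[OF assms(2)])
  then show "x \<in> range (\<lambda>u. \<Sum>i\<in>B. of_int (u (v i)) *\<^sub>R v i)"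
    by (intro image_eqI[of _ _ "\<lambda>b. u (the_inv_into B v b)"]) auto
qed

lemma int_span_subset_discrete_subgroup:
  assumes "discrete_subgroup G" "S \<subseteq> G"
  shows "int_span S \<subseteq> G"
proof (rule int_module.span_minimal[OF assms(2)])
  show "int_module.subspace G"
    unfolding int_module.subspace_def
    using discrete_subgroup_zero[OF assms(1)] discrete_subgroup_add[OF assms(1)]
      discrete_subgroup_scale_int[OF assms(1)] by blast
qed

text \<open>Passing to fractional parts subtracts an integer combination of the generators, which
  lies in \<open>G\<close>.\<close>

lemma sum_frac_family:
  assumes G: "discrete_subgroup G" and v: "v ` B \<subseteq> G" and x: "(\<Sum>i\<in>B. c i *\<^sub>R v i) \<in> G"
  shows "(\<Sum>i\<in>B. frac (c i) *\<^sub>R v i) \<in> half_open_box v B \<inter> G"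
proof
  show "(\<Sum>i\<in>B. frac (c i) *\<^sub>R v i) \<in> half_open_box v B"
    unfolding half_open_box_def
    by (intro image_eqI[of _ _ "\<lambda>i. frac (c i)"]) (auto simp: frac_lt_1)
  have "(\<Sum>i\<in>B. frac (c i) *\<^sub>R v i) = (\<Sum>i\<in>B. c i *\<^sub>R v i) - (\<Sum>i\<in>B. of_int \<lfloor>c i\<rfloor> *\<^sub>R v i)"
    by (simp add: frac_def scaleR_left_diff_distrib sum_subtractf)
  moreover have "(\<Sum>i\<in>B. of_int \<lfloor>c i\<rfloor> *\<^sub>R v i) \<in> G"
    by (intro discrete_subgroup_sum[OF G] discrete_subgroup_scale_int[OF G]) (use v in blast)
  ultimately show "(\<Sum>i\<in>B. frac (c i) *\<^sub>R v i) \<in> G"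
    using discrete_subgroup_diff[OF G x] by simp
qed

text \<open>
  Dirichlet's pigeonhole argument: the fractional parts of the multiples of a coefficient vector
  give lattice points in a bounded set, so two of them coincide.
\<close>

lemma multiples_same_frac:
  fixes v :: "'i \<Rightarrow> 'a::euclidean_space"
  assumes G: "discrete_subgroup G" and B: "finite B" and v: "v ` B \<subseteq> G"
    and x: "(\<Sum>i\<in>B. c i *\<^sub>R v i) \<in> G"
  obtains m n :: nat where "m < n"
    "(\<Sum>i\<in>B. frac (real m * c i) *\<^sub>R v i) = (\<Sum>i\<in>B. frac (real n * c i) *\<^sub>R v i)"
proof -
  define y where "y n = (\<Sum>i\<in>B. frac (real n * c i) *\<^sub>R v i)" for n :: nat
  have y: "y n \<in> half_open_box v B \<inter> G" for n
    unfolding y_def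
  proof (rule sum_frac_family[OF G v])
    have "(\<Sum>i\<in>B. (real n * c i) *\<^sub>R v i) = real n *\<^sub>R (\<Sum>i\<in>B. c i *\<^sub>R v i)"
      by (simp add: scaleR_sum_right)
    then show "(\<Sum>i\<in>B. (real n * c i) *\<^sub>R v i) \<in> G"
      using discrete_subgroup_scale_nat[OF G x] by simp
  qed
  have "finite (half_open_box v B \<inter> G)"
    by (rule discrete_subgroup_finite_bounded[OF G bounded_half_open_box[OF B]])
  then have "finite (range y)" by (rule rev_finite_subset) (use y in blast)
  then have "\<not> inj y" using range_inj_infinite by blast
  then obtain m n where "m \<noteq> n" "y m = y n" unfolding inj_def by blast
  then have "m < n \<or> n < m" "y m = y n" "y n = y m" by auto
  then show thesis using that[of m n] that[of n m] unfolding y_def by blast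
qed

section \<open>The quotient group, its cosets and its torsion\<close>

lemma comm_group_add_group_of:
  assumes "discrete_subgroup G"
  shows "comm_group (add_group_of G)"
proof (rule comm_groupI)
  fix x assume "x \<in> carrier (add_group_of G)"
  then have "0 - x \<in> carrier (add_group_of G)" "(0 - x) \<otimes>\<^bsub>add_group_of G\<^esub> x = \<one>\<^bsub>add_group_of G\<^esub>"
    using discrete_subgroup_diff[OF assms discrete_subgroup_zero[OF assms]] by (auto simp: add_group_of_def)
  then show "\<exists>y\<in>carrier (add_group_of G). y \<otimes>\<^bsub>add_group_of G\<^esub> x = \<one>\<^bsub>add_group_of G\<^esub>" by blast
qed (auto simp: add_group_of_def discrete_subgroup_zero[OF assms] discrete_subgroup_add[OF assms]
    add.assoc add.commute)

lemma pow_add_group_of: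
  fixes x :: "'a::real_vector"
  shows "x [^]\<^bsub>add_group_of G\<^esub> (k::nat) = real k *\<^sub>R x"
  by (induction k) (simp_all add: nat_pow_def add_group_of_def algebra_simps)

lemma subgroup_add_group_of:
  fixes G :: "'a::real_normed_vector set"
  assumes "discrete_subgroup G" "S \<subseteq> G"
  shows "subgroup (int_span S) (add_group_of G)"
proof -
  interpret comm_group "add_group_of G" by (rule comm_group_add_group_of[OF assms(1)])
  show ?thesis
  proof (rule subgroupI)
    show "int_span S \<subseteq> carrier (add_group_of G)"
      using int_span_subset_discrete_subgroup[OF assms] by (simp add: add_group_of_def)
    show "int_span S \<noteq> {}" using int_module.span_zero by blast
    fix a assume a: "a \<in> int_span S"
    have "a \<in> G" using a int_span_subset_discrete_subgroup[OF assms] by blast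
    then have "inv\<^bsub>add_group_of G\<^esub> a = - a"
      using discrete_subgroup_diff[OF assms(1) discrete_subgroup_zero[OF assms(1)], of a]
      by (intro inv_equality) (auto simp: add_group_of_def)
    then show "inv\<^bsub>add_group_of G\<^esub> a \<in> int_span S" using int_module.span_neg[OF a] by simp
    fix b assume "b \<in> int_span S"
    then show "a \<otimes>\<^bsub>add_group_of G\<^esub> b \<in> int_span S"
      using int_module.span_add[OF a] by (simp add: add_group_of_def)
  qed
qed

lemma coset_int_span_eq_iff:
  "int_span S #>\<^bsub>add_group_of G\<^esub> x = int_span S #>\<^bsub>add_group_of G\<^esub> y \<longleftrightarrow> x - y \<in> int_span S"
proof -
  have mem: "z \<in> int_span S #>\<^bsub>add_group_of G\<^esub> x \<longleftrightarrow> z - x \<in> int_span S" for z x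
  proof -
    have "z \<in> int_span S #>\<^bsub>add_group_of G\<^esub> x \<longleftrightarrow> (\<exists>h\<in>int_span S. z = h + x)"
      by (auto simp: r_coset_def add_group_of_def)
    also have "\<dots> \<longleftrightarrow> z - x \<in> int_span S" by (auto intro: bexI[of _ "z - x"])
    finally show ?thesis .
  qed
  show ?thesis
  proof
    assume "int_span S #>\<^bsub>add_group_of G\<^esub> x = int_span S #>\<^bsub>add_group_of G\<^esub> y"
    moreover have "x \<in> int_span S #>\<^bsub>add_group_of G\<^esub> x" unfolding mem by (simp add: int_module.span_zero)
    ultimately show "x - y \<in> int_span S" using mem by simp
  next
    assume xy: "x - y \<in> int_span S"
    have "z - x \<in> int_span S \<longleftrightarrow> z - y \<in> int_span S" for z
      using int_module.span_add[OF _ xy, of "z - x"] int_module.span_diff[OF _ xy, of "z - y"]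
      by auto
    then show "int_span S #>\<^bsub>add_group_of G\<^esub> x = int_span S #>\<^bsub>add_group_of G\<^esub> y"
      using mem by blast
  qed
qed

text \<open>Powers in the quotient are cosets of multiples, which turns torsion into a condition on
  representatives: some positive multiple lies in the subgroup.\<close>

lemma torsion_quotient_int_span:
  fixes G :: "'a::real_normed_vector set"
  assumes "discrete_subgroup G" "S \<subseteq> G"
  shows "torsion (add_group_of G Mod int_span S) =
    (\<lambda>x. int_span S #>\<^bsub>add_group_of G\<^esub> x) ` {x \<in> G. \<exists>k::nat. k > 0 \<and> real k *\<^sub>R x \<in> int_span S}"
proof -
  interpret comm_group "add_group_of G" by (rule comm_group_add_group_of[OF assms(1)])
  interpret normal "int_span S" "add_group_of G"
    by (rule subgroup_imp_normal[OF subgroup_add_group_of[OF assms]])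
  have carr: "carrier (add_group_of G) = G" by (simp add: add_group_of_def)
  have one: "int_span S #>\<^bsub>add_group_of G\<^esub> 0 = int_span S"
    using coset_mult_one[OF subset] by (simp add: add_group_of_def)
  have pow: "(int_span S #>\<^bsub>add_group_of G\<^esub> x) [^]\<^bsub>add_group_of G Mod int_span S\<^esub> k = \<one>\<^bsub>add_group_of G Mod int_span S\<^esub>
      \<longleftrightarrow> real k *\<^sub>R x \<in> int_span S" if "x \<in> G" for x and k :: nat
  proof -
    have "(int_span S #>\<^bsub>add_group_of G\<^esub> x) [^]\<^bsub>add_group_of G Mod int_span S\<^esub> k
        = int_span S #>\<^bsub>add_group_of G\<^esub> (real k *\<^sub>R x)"
      using FactGroup_pow[of x k] that by (simp add: carr pow_add_group_of)
    then show ?thesis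
      using coset_int_span_eq_iff[where S = S and G = G and x = "real k *\<^sub>R x" and y = 0] one by simp
  qed
  have "torsion (add_group_of G Mod int_span S) =
      (\<lambda>x. int_span S #>\<^bsub>add_group_of G\<^esub> x) ` {x \<in> G. \<exists>k::nat. k > 0 \<and>
        (int_span S #>\<^bsub>add_group_of G\<^esub> x) [^]\<^bsub>add_group_of G Mod int_span S\<^esub> k = \<one>\<^bsub>add_group_of G Mod int_span S\<^esub>}"
    unfolding torsion_def carrier_FactGroup carr by blast
  also have "{x \<in> G. \<exists>k::nat. k > 0 \<and>
        (int_span S #>\<^bsub>add_group_of G\<^esub> x) [^]\<^bsub>add_group_of G Mod int_span S\<^esub> k = \<one>\<^bsub>add_group_of G Mod int_span S\<^esub>}
      = {x \<in> G. \<exists>k::nat. k > 0 \<and> real k *\<^sub>R x \<in> int_span S}"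
    using pow by (intro Collect_cong conj_cong refl) simp
  finally show ?thesis .
qed

text \<open>Fractional parts move any torsion coset to a representative in the box. Two
  representatives of one coset have coefficients that differ by integers of absolute value below 1,
  hence agree. That every lattice point of the box is torsion comes from the pigeonhole
  argument.\<close>

lemma card_torsion_quotient:
  fixes v :: "'i \<Rightarrow> 'a::euclidean_space"
  assumes G: "discrete_subgroup G" and B: "finite B" and v: "v ` B \<subseteq> G" and L: "lin_indep_family v B"
  shows "card (torsion (add_group_of G Mod int_span (v ` B))) = card (half_open_box v B \<inter> G)"
proof -
  let ?H = "int_span (v ` B)"
  let ?coset = "\<lambda>x. ?H #>\<^bsub>add_group_of G\<^esub> x"
  have inj: "inj_on v B" using L lin_indep_family_iff[OF B] by blast
  note H = int_span_image[OF B inj]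
  have frac: "(\<Sum>i\<in>B. c i *\<^sub>R v i) - (\<Sum>i\<in>B. frac (c i) *\<^sub>R v i) \<in> ?H" for c
  proof -
    have "(\<Sum>i\<in>B. c i *\<^sub>R v i) - (\<Sum>i\<in>B. frac (c i) *\<^sub>R v i) = (\<Sum>i\<in>B. of_int \<lfloor>c i\<rfloor> *\<^sub>R v i)"
      by (simp add: frac_def scaleR_left_diff_distrib sum_subtractf)
    then show ?thesis unfolding H by (intro image_eqI[of _ _ "\<lambda>i. \<lfloor>c i\<rfloor>"]) auto
  qed
  have "bij_betw ?coset (half_open_box v B \<inter> G) (torsion (add_group_of G Mod ?H))"
    unfolding torsion_quotient_int_span[OF G v]
  proof (rule bij_betw_imageI)
    show "inj_on ?coset (half_open_box v B \<inter> G)"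
    proof (rule inj_onI)
      fix x y assume x: "x \<in> half_open_box v B \<inter> G" and y: "y \<in> half_open_box v B \<inter> G"
        and "?coset x = ?coset y"
      then have "x - y \<in> ?H" unfolding coset_int_span_eq_iff by simp
      then obtain u where u: "x - y = (\<Sum>i\<in>B. of_int (u i) *\<^sub>R v i)" unfolding H by blast
      obtain c where c: "x = (\<Sum>i\<in>B. c i *\<^sub>R v i)" "\<forall>i\<in>B. 0 \<le> c i \<and> c i < 1"
        using x unfolding half_open_box_def by blast
      obtain d where d: "y = (\<Sum>i\<in>B. d i *\<^sub>R v i)" "\<forall>i\<in>B. 0 \<le> d i \<and> d i < 1"
        using y unfolding half_open_box_def by blast
      have eq: "(\<Sum>i\<in>B. (c i - d i) *\<^sub>R v i) = (\<Sum>i\<in>B. of_int (u i) *\<^sub>R v i)"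
        using u unfolding c(1) d(1) by (simp add: scaleR_left_diff_distrib sum_subtractf)
      have "c i = d i" if i: "i \<in> B" for i
      proof -
        have cd: "c i - d i = of_int (u i)" by (rule lin_indep_family_unique[OF L eq i])
        have "\<bar>c i - d i\<bar> < 1" using c(2) d(2) i by force
        then have "u i = 0" unfolding cd by linarith
        then show ?thesis using cd by simp
      qed
      then show "x = y" unfolding c(1) d(1) by (intro sum.cong) auto
    qed
    show "?coset ` (half_open_box v B \<inter> G) = ?coset ` {x \<in> G. \<exists>k::nat. k > 0 \<and> real k *\<^sub>R x \<in> ?H}"
    proof (intro equalityI subsetI)
      fix X assume "X \<in> ?coset ` (half_open_box v B \<inter> G)"
      then obtain c where c: "X = ?coset (\<Sum>i\<in>B. c i *\<^sub>R v i)" "(\<Sum>i\<in>B. c i *\<^sub>R v i) \<in> G"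
        unfolding half_open_box_def by blast
      obtain m n :: nat where mn: "m < n"
        "(\<Sum>i\<in>B. frac (real m * c i) *\<^sub>R v i) = (\<Sum>i\<in>B. frac (real n * c i) *\<^sub>R v i)"
        by (rule multiples_same_frac[OF G B v c(2)])
      \<comment> \<open>The two fractional sums coincide, so \<open>n - m\<close> times the point
        equals this difference of integer combinations.\<close>
      have "((\<Sum>i\<in>B. (real n * c i) *\<^sub>R v i) - (\<Sum>i\<in>B. frac (real n * c i) *\<^sub>R v i))
          - ((\<Sum>i\<in>B. (real m * c i) *\<^sub>R v i) - (\<Sum>i\<in>B. frac (real m * c i) *\<^sub>R v i)) \<in> ?H"
        by (intro int_module.span_diff frac)
      moreover have "real (n - m) *\<^sub>R (\<Sum>i\<in>B. c i *\<^sub>R v i)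
          = (\<Sum>i\<in>B. (real n * c i) *\<^sub>R v i) - (\<Sum>i\<in>B. (real m * c i) *\<^sub>R v i)"
        using mn(1) by (simp add: of_nat_diff left_diff_distrib scaleR_left_diff_distrib scaleR_sum_right sum_subtractf)
      ultimately have "real (n - m) *\<^sub>R (\<Sum>i\<in>B. c i *\<^sub>R v i) \<in> ?H" using mn(2) by simp
      then have "(\<Sum>i\<in>B. c i *\<^sub>R v i) \<in> {x \<in> G. \<exists>k::nat. k > 0 \<and> real k *\<^sub>R x \<in> ?H}"
        using c(2) mn(1) by (intro CollectI conjI exI[of _ "n - m"]) auto
      then show "X \<in> ?coset ` {x \<in> G. \<exists>k::nat. k > 0 \<and> real k *\<^sub>R x \<in> ?H}"
        unfolding c(1) by (rule imageI)
    next
      fix X assume "X \<in> ?coset ` {x \<in> G. \<exists>k::nat. k > 0 \<and> real k *\<^sub>R x \<in> ?H}"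
      then obtain x and k :: nat where x: "X = ?coset x" "x \<in> G" "k > 0" "real k *\<^sub>R x \<in> ?H" by blast
      obtain u where u: "real k *\<^sub>R x = (\<Sum>i\<in>B. of_int (u i) *\<^sub>R v i)" using x(4) unfolding H by blast
      \<comment> \<open>A torsion element has rational coordinates with denominator
        \<open>k\<close>.\<close>
      define c where "c i = of_int (u i) / real k" for i
      have "x = (1 / real k) *\<^sub>R (real k *\<^sub>R x)" using x(3) by simp
      also have "\<dots> = (\<Sum>i\<in>B. c i *\<^sub>R v i)" unfolding u c_def by (simp add: scaleR_sum_right)
      finally have xc: "x = (\<Sum>i\<in>B. c i *\<^sub>R v i)" .
      have "(\<Sum>i\<in>B. frac (c i) *\<^sub>R v i) \<in> half_open_box v B \<inter> G"
        using x(2) unfolding xc by (rule sum_frac_family[OF G v])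
      moreover have "X = ?coset (\<Sum>i\<in>B. frac (c i) *\<^sub>R v i)"
        unfolding x(1) coset_int_span_eq_iff xc by (rule frac)
      ultimately show "X \<in> ?coset ` (half_open_box v B \<inter> G)" by blast
    qed
  qed
  then show ?thesis by (rule bij_betw_same_card[symmetric])
qed

subsection \<open>Lattices and ranks\<close>

text \<open>The coordinate functionals of a basis independent over the reals extend to bounded
  functionals on the whole space, so the integer coordinates of lattice points in a ball are
  bounded.\<close>

lemma lattice_imp_discrete_subgroup:
  fixes \<Gamma> :: "'a::euclidean_space set"
  assumes "is_lattice \<Gamma>"
  shows "discrete_subgroup \<Gamma>"
proof -
  obtain B where B: "finite B" "independent B" "\<Gamma> = int_span B"
    using assms unfolding is_lattice_def by blast
  have "\<forall>b. \<exists>g::'a \<Rightarrow> real. linear g \<and> (\<forall>x\<in>B. g x = (if x = b then 1 else 0))"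
    by (intro allI) (rule linear_independent_extend[OF B(2)])
  from choice[OF this] obtain F :: "'a \<Rightarrow> 'a \<Rightarrow> real"
    where F: "\<And>b. linear (F b)" "\<And>b x. x \<in> B \<Longrightarrow> F b x = (if x = b then 1 else 0)"
    by blast
  have "\<forall>b. \<exists>K. \<forall>x. norm (F b x) \<le> K * norm x" using linear_bounded[OF F(1)] by blast
  from choice[OF this] obtain K where K: "\<And>b x. norm (F b x) \<le> K b * norm x" by blast
  have "finite {x \<in> \<Gamma>. norm x \<le> R}" for R
  proof -
    \<comment> \<open>A bound for the coordinate at \<open>b\<close> on the ball; the absolute value
      is there because no sign of \<open>K b\<close> has been established.\<close>
    define N where "N b = \<lceil>\<bar>K b\<bar> * R\<rceil>" for b
    have "{x \<in> \<Gamma>. norm x \<le> R} \<subseteq> (\<lambda>u. \<Sum>b\<in>B. of_int (u b) *\<^sub>R b) ` (PiE B (\<lambda>b. {- N b..N b}))"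
    proof
      fix x assume x: "x \<in> {x \<in> \<Gamma>. norm x \<le> R}"
      then obtain u where u: "x = (\<Sum>b\<in>B. of_int (u b) *\<^sub>R b)"
        unfolding B(3) int_module.span_finite[OF B(1)] by blast
      have "u b \<in> {- N b..N b}" if b: "b \<in> B" for b
      proof -
        have "F b x = (\<Sum>a\<in>B. of_int (u a) * (if a = b then 1 else 0))"
          unfolding u by (simp add: linear_sum[OF F(1)] linear_scale[OF F(1)] F(2) cong: sum.cong)
        also have "\<dots> = of_int (u b)"
          using B(1) b by (simp add: if_distrib cong: if_cong)
        finally have "\<bar>of_int (u b)\<bar> = norm (F b x)" by simp
        also have "\<dots> \<le> K b * norm x" by (rule K)
        also have "\<dots> \<le> \<bar>K b\<bar> * norm x" by (intro mult_right_mono) auto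
        also have "\<dots> \<le> \<bar>K b\<bar> * R" using x by (intro mult_left_mono) auto
        also have "\<dots> \<le> of_int (N b)" unfolding N_def by (rule le_of_int_ceiling)
        finally have "\<bar>real_of_int (u b)\<bar> \<le> real_of_int (N b)" .
        then show ?thesis by simp linarith
      qed
      \<comment> \<open>Coefficients outside \<open>B\<close> are arbitrary; \<open>restrict\<close>
        fixes them as the finite function space demands.\<close>
      then have "restrict u B \<in> PiE B (\<lambda>b. {- N b..N b})" by auto
      moreover have "x = (\<Sum>b\<in>B. of_int (restrict u B b) *\<^sub>R b)" unfolding u by (intro sum.cong) auto
      ultimately show "x \<in> (\<lambda>u. \<Sum>b\<in>B. of_int (u b) *\<^sub>R b) ` (PiE B (\<lambda>b. {- N b..N b}))" by blast
    qed
    then show ?thesis by (rule finite_subset) (intro finite_imageI finite_PiE B(1), simp)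
  qed
  then show ?thesis
    unfolding discrete_subgroup_def B(3) using int_module.span_zero int_module.span_diff by blast
qed

section \<open>Integral rank and real dimension\<close>

text \<open>Discreteness is essential: 1 and an irrational number are dependent over the reals but
  not over the integers. The pigeonhole argument turns a real relation into an integral one by
  rounding two of its multiples.\<close>

lemma int_dependent_iff_dependent:
  fixes B :: "'a::euclidean_space set"
  assumes G: "discrete_subgroup G" and B: "finite B" "B \<subseteq> G"
  shows "int_dependent B \<longleftrightarrow> dependent B"
proof
  assume "int_dependent B"
  then obtain u b where "b \<in> B" "u b \<noteq> 0" "(\<Sum>b\<in>B. of_int (u b) *\<^sub>R b) = 0"
    unfolding int_module.dependent_finite[OF B(1)] by blast
  then show "dependent B"
    unfolding real_vector.dependent_finite[OF B(1)] by (intro exI[of _ "\<lambda>b. of_int (u b)"]) auto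
next
  assume "dependent B"
  then obtain c' b0 where c': "b0 \<in> B" "c' b0 \<noteq> 0" "(\<Sum>b\<in>B. c' b *\<^sub>R b) = 0"
    unfolding real_vector.dependent_finite[OF B(1)] by blast
  \<comment> \<open>With the coefficient at \<open>b0\<close> normalised to 1, rounding is exact
    there, and the integral relation has the nonzero coefficient \<open>n - m\<close>.\<close>
  define c where "c b = c' b / c' b0" for b
  have "(\<Sum>b\<in>B. c b *\<^sub>R b) = (1 / c' b0) *\<^sub>R (\<Sum>b\<in>B. c' b *\<^sub>R b)"
    unfolding c_def scaleR_sum_right by simp
  then have c: "(\<Sum>b\<in>B. c b *\<^sub>R b) = 0" "c b0 = 1" using c' by (auto simp: c_def)
  obtain m n :: nat where mn: "m < n"
    "(\<Sum>b\<in>B. frac (real m * c b) *\<^sub>R b) = (\<Sum>b\<in>B. frac (real n * c b) *\<^sub>R b)"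
  proof (rule multiples_same_frac[OF G B(1), of "\<lambda>b. b" c])
    show "(\<lambda>b. b) ` B \<subseteq> G" using B(2) by simp
    show "(\<Sum>b\<in>B. c b *\<^sub>R b) \<in> G" unfolding c(1) by (rule discrete_subgroup_zero[OF G])
  qed
  have fl: "(\<Sum>b\<in>B. of_int \<lfloor>real k * c b\<rfloor> *\<^sub>R b) = - (\<Sum>b\<in>B. frac (real k * c b) *\<^sub>R b)" for k
  proof -
    have "(\<Sum>b\<in>B. of_int \<lfloor>real k * c b\<rfloor> *\<^sub>R b)
        = (\<Sum>b\<in>B. (real k * c b) *\<^sub>R b) - (\<Sum>b\<in>B. frac (real k * c b) *\<^sub>R b)"
      by (simp add: frac_def scaleR_left_diff_distrib sum_subtractf)
    also have "(\<Sum>b\<in>B. (real k * c b) *\<^sub>R b) = real k *\<^sub>R (\<Sum>b\<in>B. c b *\<^sub>R b)"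
      by (simp add: scaleR_sum_right)
    finally show ?thesis using c(1) by simp
  qed
  define u where "u b = \<lfloor>real n * c b\<rfloor> - \<lfloor>real m * c b\<rfloor>" for b
  have "(\<Sum>b\<in>B. of_int (u b) *\<^sub>R b) = 0"
    using fl[of n] fl[of m] mn(2) by (simp add: u_def scaleR_left_diff_distrib sum_subtractf)
  moreover have "u b0 \<noteq> 0" using mn(1) by (simp add: u_def c(2))
  ultimately show "int_dependent B"
    unfolding int_module.dependent_finite[OF B(1)] using c'(1) by blast
qed

text \<open>Integrally independent subsets of the span are independent over the reals, so the
  dimension bounds them; a real basis chosen inside \<open>S\<close> attains it.\<close>

lemma group_rank_int_span:
  fixes S :: "'a::euclidean_space set"
  assumes G: "discrete_subgroup G" and S: "finite S" "S \<subseteq> G"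
  shows "group_rank (int_span S) = dim S"
proof -
  have "x \<in> span S" if x: "x \<in> int_span S" for x
  proof -
    obtain u where u: "x = (\<Sum>b\<in>S. of_int (u b) *\<^sub>R b)"
      using x unfolding int_module.span_finite[OF S(1)] by blast
    show ?thesis unfolding u by (intro span_sum span_scale span_base)
  qed
  then have span: "int_span S \<subseteq> span S" by blast
  let ?C = "{card B | B. finite B \<and> B \<subseteq> int_span S \<and> \<not> int_dependent B}"
  have le: "k \<le> dim S" if k: "k \<in> ?C" for k
  proof -
    obtain B where B: "k = card B" "finite B" "B \<subseteq> int_span S" "\<not> int_dependent B" using k by blast
    have "B \<subseteq> G" using B(3) int_span_subset_discrete_subgroup[OF G S(2)] by blast
    then have "independent B" using int_dependent_iff_dependent[OF G B(2)] B(4) by blast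
    then show ?thesis
      using independent_card_le_dim[of B "span S"] B(1,3) span by auto
  qed
  obtain B where B: "B \<subseteq> S" "independent B" "S \<subseteq> span B" "card B = dim S"
    using basis_exists[of S] by blast
  have fB: "finite B" using B(1) S(1) finite_subset by blast
  have "\<not> int_dependent B" using int_dependent_iff_dependent[OF G fB] B(1,2) S(2) by blast
  moreover have "B \<subseteq> int_span S" using B(1) int_module.span_superset by blast
  ultimately have "dim S \<in> ?C" using fB B(4) by (metis (mono_tags, lifting) mem_Collect_eq)
  \<comment> \<open>\<open>Max\<close> is meaningful only on a finite set, and the dimension bound
    ensures this.\<close>
  moreover have "finite ?C" using le by (intro finite_subset[of ?C "{..dim S}"]) auto
  ultimately show ?thesis unfolding group_rank_def using le by (intro Max_eqI)
qed

lemma rk_eq_dim: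
  fixes E :: "'a::euclidean_space list"
  assumes "discrete_subgroup G" "set E \<subseteq> G" "A \<subseteq> {..<length E}"
  shows "rk E A = dim ((!) E ` A)"
  unfolding rk_def gen_subgroup_def
proof (rule group_rank_int_span[OF assms(1)])
  show "finite ((!) E ` A)" using assms(3) finite_subset by blast
  show "(!) E ` A \<subseteq> G" using assms(2,3) by (auto simp: subset_iff)
qed

text \<open>In the chain from the dimension to the size of the image to \<open>card A\<close>,
  equality of the ends forces both independence and injectivity.\<close>

lemma lin_indep_sublist_iff_dim:
  fixes E :: "'a::euclidean_space list"
  assumes "finite A"
  shows "lin_indep_sublist E A \<longleftrightarrow> dim ((!) E ` A) = card A"
proof
  assume "lin_indep_sublist E A"
  then show "dim ((!) E ` A) = card A"
    unfolding lin_indep_sublist_def by (simp add: dim_eq_card_independent card_image)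
next
  assume eq: "dim ((!) E ` A) = card A"
  have "dim ((!) E ` A) \<le> card ((!) E ` A)" by (rule dim_le_card'[OF finite_imageI[OF assms]])
  then have ci: "card ((!) E ` A) = card A" using eq card_image_le[OF assms, of "(!) E"] by simp
  then have "inj_on ((!) E) A" by (rule eq_card_imp_inj_on[OF assms])
  moreover have "independent ((!) E ` A)"
    using card_eq_dim[OF order_refl, of "(!) E ` A"] eq ci finite_imageI[OF assms, of "(!) E"]
      span_superset[of "(!) E ` A"] by simp
  ultimately show "lin_indep_sublist E A" unfolding lin_indep_sublist_def by blast
qed

subsection \<open>The Ehrhart polynomial of a zonotope\<close>

lemma zonotope_eq_zono: "zonotope E A = zono ((!) E) A"
  unfolding zonotope_def zono_def by blast

lemma lin_indep_sublist_iff_family: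
  "finite B \<Longrightarrow> lin_indep_sublist E B \<longleftrightarrow> lin_indep_family ((!) E) B"
  unfolding lin_indep_sublist_def by (rule lin_indep_family_iff[symmetric])

text \<open>Dilating a zonotope dilates its generators, so the half-open decomposition applies to
  the same group. Each box then yields a power of \<open>k\<close> and a torsion count.\<close>

lemma card_dilated_zonotope:
  fixes E :: "'a::euclidean_space list"
  assumes G: "discrete_subgroup G" and E: "set E \<subseteq> G" and A: "A \<subseteq> {..<length E}" and k: "k > 0"
  shows "card ((*\<^sub>R) (real k) ` zonotope E A \<inter> G)
    = (\<Sum>B | B \<subseteq> A \<and> lin_indep_sublist E B. k ^ card B * multip G E B)"
proof -
  have finA: "finite A" using A finite_subset by blast
  have EG: "(!) E ` B \<subseteq> G" if "B \<subseteq> A" for B using that A E by (auto simp: subset_iff)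
  have lin: "linear ((*\<^sub>R) (real k) :: 'a \<Rightarrow> 'a)" by (rule linearI) (simp_all add: algebra_simps)
  have kn: "real k \<noteq> 0" using k by simp
  have "(*\<^sub>R) (real k) ` zonotope E A = zono (\<lambda>i. real k *\<^sub>R E ! i) A"
    unfolding zonotope_eq_zono by (rule linear_image_zono[OF lin])
  then have "card ((*\<^sub>R) (real k) ` zonotope E A \<inter> G)
      = (\<Sum>B | B \<subseteq> A \<and> lin_indep_family (\<lambda>i. real k *\<^sub>R E ! i) B. card (half_open_box (\<lambda>i. real k *\<^sub>R E ! i) B \<inter> G))"
    using card_zono_eq_sum_half_open_boxes[OF finA G, of "\<lambda>i. real k *\<^sub>R E ! i"]
      EG[OF order_refl] discrete_subgroup_scale_nat[OF G] by (simp add: image_subset_iff)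
  also have "\<dots> = (\<Sum>B | B \<subseteq> A \<and> lin_indep_sublist E B. k ^ card B * multip G E B)"
  proof (rule sum.cong)
    show "{B. B \<subseteq> A \<and> lin_indep_family (\<lambda>i. real k *\<^sub>R E ! i) B} = {B. B \<subseteq> A \<and> lin_indep_sublist E B}"
      unfolding lin_indep_family_scale[OF kn]
      using lin_indep_sublist_iff_family finite_subset[OF _ finA] by blast
    fix B assume "B \<in> {B. B \<subseteq> A \<and> lin_indep_sublist E B}"
    then have B: "B \<subseteq> A" "finite B" "lin_indep_family ((!) E) B"
      using lin_indep_sublist_iff_family finite_subset[OF _ finA] by blast+
    show "card (half_open_box (\<lambda>i. real k *\<^sub>R E ! i) B \<inter> G) = k ^ card B * multip G E B"
      unfolding multip_def gen_subgroup_def card_torsion_quotient[OF G B(2) EG[OF B(1)] B(3)]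
      by (rule card_half_open_box_scale[OF B(2) G EG[OF B(1)] B(3) k])
  qed
  finally show ?thesis .
qed

text \<open>Supplies the uniqueness behind the definite description in
  \<open>ehrhart_polynomial\<close>: the difference would have infinitely many roots.\<close>

lemma poly_eq_if_eq_on_positive_nats:
  fixes p q :: "real poly"
  assumes "\<And>k::nat. k > 0 \<Longrightarrow> poly p (real k) = poly q (real k)"
  shows "p = q"
proof (rule ccontr)
  assume "p \<noteq> q"
  then have "finite {x. poly (p - q) x = 0}" by (intro poly_roots_finite) simp
  moreover have "real ` {0<..} \<subseteq> {x. poly (p - q) x = 0}" using assms by auto
  ultimately have "finite (real ` {0<..})" by (rule rev_finite_subset)
  then have "finite {0::nat<..}" by (rule finite_imageD) (simp add: inj_on_def)
  then show False using infinite_Ioi by blast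
qed

lemma ehrhart_polynomial_zonotope:
  fixes E :: "'a::euclidean_space list"
  assumes G: "discrete_subgroup G" and E: "set E \<subseteq> G" and A: "A \<subseteq> {..<length E}"
  shows "ehrhart_polynomial G (zonotope E A)
    = (\<Sum>B | B \<subseteq> A \<and> lin_indep_sublist E B. monom (real (multip G E B)) (card B))"
    (is "_ = ?q")
proof -
  have q: "poly ?q (real k) = real (card ((*\<^sub>R) (real k) ` zonotope E A \<inter> G))" if "k > 0" for k
    unfolding card_dilated_zonotope[OF assms that] by (simp add: poly_sum poly_monom mult.commute)
  show ?thesis unfolding ehrhart_polynomial_def
  proof (rule the_equality)
    show "\<forall>k::nat. k > 0 \<longrightarrow> poly ?q (real k) = real (card ((*\<^sub>R) (real k) ` zonotope E A \<inter> G))"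
      using q by blast
    fix r assume "\<forall>k::nat. k > 0 \<longrightarrow> poly r (real k) = real (card ((*\<^sub>R) (real k) ` zonotope E A \<inter> G))"
    then show "r = ?q" by (intro poly_eq_if_eq_on_positive_nats) (simp only: q)
  qed
qed

subsection \<open>Random sublists\<close>

lemma set_pmf_random_sublist: "set_pmf (random_sublist E p) \<subseteq> Pow {..<length E}"
  unfolding random_sublist_def by auto

lemma integrable_random_sublist:
  fixes f :: "nat set \<Rightarrow> real"
  shows "integrable (measure_pmf (random_sublist E p)) f"
  by (intro integrable_measure_pmf_finite finite_subset[OF set_pmf_random_sublist]) simp

text \<open>The indicator factors over the positions, so independence turns its expectation into a
  product.\<close>

lemma expectation_superset_random_sublist:
  assumes p: "\<forall>i<length E. 0 \<le> p i \<and> p i \<le> 1" and B: "B \<subseteq> {..<length E}"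
  shows "measure_pmf.expectation (random_sublist E p) (\<lambda>A. of_bool (B \<subseteq> A)) = (\<Prod>i\<in>B. p i)"
proof -
  let ?n = "length E"
  \<comment> \<open>Positions outside \<open>B\<close> impose no condition and contribute the factor
    1.\<close>
  define f :: "nat \<Rightarrow> bool \<Rightarrow> real" where "f i b = (if i \<in> B then of_bool b else 1)" for i b
  have prod: "of_bool (B \<subseteq> {i \<in> {..<?n}. \<omega> i}) = (\<Prod>i<?n. f i (\<omega> i))" for \<omega>
  proof (cases "B \<subseteq> {i \<in> {..<?n}. \<omega> i}")
    case True
    then have "(\<Prod>i<?n. f i (\<omega> i)) = 1" unfolding f_def by (intro prod.neutral) auto
    then show ?thesis using True by simp
  next
    case False
    then obtain i where "i \<in> B" "\<not> \<omega> i" using B by blast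
    then have "i \<in> {..<?n}" "f i (\<omega> i) = 0" using B by (auto simp: f_def)
    then have "(\<Prod>i<?n. f i (\<omega> i)) = 0" by (intro prod_zero) auto
    then show ?thesis using False by simp
  qed
  have "measure_pmf.expectation (random_sublist E p) (\<lambda>A. of_bool (B \<subseteq> A))
      = measure_pmf.expectation (Pi_pmf {..<?n} False (\<lambda>i. bernoulli_pmf (p i))) (\<lambda>\<omega>. \<Prod>i<?n. f i (\<omega> i))"
    unfolding random_sublist_def integral_map_pmf prod ..
  also have "\<dots> = (\<Prod>i<?n. measure_pmf.expectation (bernoulli_pmf (p i)) (f i))"
    by (rule expectation_prod_Pi_pmf) (auto simp: f_def intro!: integrable_measure_pmf_finite)
  also have "\<dots> = (\<Prod>i<?n. if i \<in> B then p i else 1)"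
    using p by (intro prod.cong refl) (simp add: f_def)
  also have "\<dots> = (\<Prod>i\<in>B. p i)"
    using B by (simp add: prod.If_cases Int_absorb1)
  finally show ?thesis .
qed

lemma expectation_ehrhart_polynomial:
  fixes E :: "'a::euclidean_space list"
  assumes G: "discrete_subgroup G" and E: "set E \<subseteq> G" and p: "\<forall>i<length E. 0 \<le> p i \<and> p i \<le> 1"
  shows "measure_pmf.expectation (random_sublist E p) (\<lambda>A. poly (ehrhart_polynomial G (zonotope E A)) t)
    = multivariate_ehrhart G E (\<lambda>i. p i * t)"
proof -
  define S where "S = {B. B \<subseteq> {..<length E} \<and> lin_indep_sublist E B}"
  have finS: "finite S" unfolding S_def by simp
  have poly: "poly (ehrhart_polynomial G (zonotope E A)) t
      = (\<Sum>B\<in>S. real (multip G E B) * t ^ card B * of_bool (B \<subseteq> A))" if A: "A \<subseteq> {..<length E}" for A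
  proof -
    have "poly (ehrhart_polynomial G (zonotope E A)) t
        = (\<Sum>B | B \<subseteq> A \<and> lin_indep_sublist E B. real (multip G E B) * t ^ card B)"
      unfolding ehrhart_polynomial_zonotope[OF G E A] by (simp add: poly_sum poly_monom)
    also have "\<dots> = (\<Sum>B | B \<subseteq> A \<and> lin_indep_sublist E B. real (multip G E B) * t ^ card B * of_bool (B \<subseteq> A))"
      by (intro sum.cong) auto
    \<comment> \<open>The sum now ranges over a set independent of \<open>A\<close>, and the
      dependence on \<open>A\<close> sits in the indicator, so the expectation can act term by
      term.\<close>
    also have "\<dots> = (\<Sum>B\<in>S. real (multip G E B) * t ^ card B * of_bool (B \<subseteq> A))"
      using A by (intro sum.mono_neutral_left finS) (auto simp: S_def)
    finally show ?thesis .
  qed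
  \<comment> \<open>The expansion is known only for sets of positions of \<open>E\<close>, which is
    where the distribution is supported.\<close>
  have "measure_pmf.expectation (random_sublist E p) (\<lambda>A. poly (ehrhart_polynomial G (zonotope E A)) t)
      = measure_pmf.expectation (random_sublist E p)
          (\<lambda>A. \<Sum>B\<in>S. real (multip G E B) * t ^ card B * of_bool (B \<subseteq> A))"
    by (intro Bochner_Integration.integral_cong_AE AE_pmfI poly)
      (use set_pmf_random_sublist[of E p] in auto)
  also have "\<dots> = (\<Sum>B\<in>S. real (multip G E B) * t ^ card B *
      measure_pmf.expectation (random_sublist E p) (\<lambda>A. of_bool (B \<subseteq> A)))"
    by (simp add: Bochner_Integration.integral_sum integrable_random_sublist)
  also have "\<dots> = (\<Sum>B\<in>S. real (multip G E B) * (\<Prod>i\<in>B. p i * t))"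
    by (intro sum.cong refl)
      (simp add: S_def expectation_superset_random_sublist[OF p] prod.distrib)
  finally show ?thesis unfolding multivariate_ehrhart_def S_def .
qed

section \<open>Specialisation to the arithmetic Tutte polynomial\<close>

text \<open>At second argument 1 the nullity factor is a power of 0, which by
  \<open>0 ^ 0 = 1\<close> selects exactly the independent sublists. The corank factor lowers the
  exponent of \<open>x\<close> from the full rank to the rank of \<open>A\<close>, its size.\<close>

lemma multivariate_ehrhart_const:
  fixes E :: "'a::euclidean_space list"
  assumes G: "discrete_subgroup G" and E: "set E \<subseteq> G" and x: "x \<noteq> 0"
  shows "multivariate_ehrhart G E (\<lambda>_. x)
    = x ^ rk E {..<length E} * arith_tutte {..<length E} (rk E) (multip G E) (1 + inverse x) 1"
proof -
  let ?N = "{..<length E}"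
  have "x ^ rk E ?N * (real (multip G E A) * inverse x ^ (rk E ?N - rk E A) * 0 ^ (card A - rk E A))
      = (if lin_indep_sublist E A then real (multip G E A) * (\<Prod>i\<in>A. x) else 0)" if A: "A \<subseteq> ?N" for A
  proof -
    have finA: "finite A" using A finite_subset by blast
    have rA: "rk E A = dim ((!) E ` A)" by (rule rk_eq_dim[OF G E A])
    have rE: "rk E ?N = dim ((!) E ` ?N)" by (rule rk_eq_dim[OF G E order_refl])
    \<comment> \<open>This and the next inequality keep the truncated subtractions in the exponents
      faithful.\<close>
    have le: "rk E A \<le> rk E ?N" unfolding rA rE by (intro dim_subset image_mono A)
    have "rk E A \<le> card A"
      unfolding rA using dim_le_card'[OF finite_imageI[OF finA]] card_image_le[OF finA] order_trans by blast
    moreover have "lin_indep_sublist E A \<longleftrightarrow> rk E A = card A"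
      unfolding rA by (rule lin_indep_sublist_iff_dim[OF finA])
    moreover have "x ^ rk E ?N * inverse x ^ (rk E ?N - rk E A) = x ^ rk E A"
      using le x by (simp add: power_diff power_inverse field_simps)
    ultimately show ?thesis by (auto simp: algebra_simps)
  qed
  then have "x ^ rk E ?N * arith_tutte ?N (rk E) (multip G E) (1 + inverse x) 1
      = (\<Sum>A\<in>Pow ?N. if lin_indep_sublist E A then real (multip G E A) * (\<Prod>i\<in>A. x) else 0)"
    unfolding arith_tutte_def sum_distrib_left by (intro sum.cong refl) simp
  also have "\<dots> = (\<Sum>A | A \<in> Pow ?N \<and> lin_indep_sublist E A. real (multip G E A) * (\<Prod>i\<in>A. x))"
    by (rule sum.inter_filter[symmetric]) simp
  finally show ?thesis unfolding multivariate_ehrhart_def by simp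
qed

theorem theorem3p17:
  fixes \<Gamma> :: "(real ^ 'n) set" and E :: "(real ^ 'n) list"
  assumes "is_lattice \<Gamma>" and "set E \<subseteq> \<Gamma>"
  shows "(\<forall>p::nat \<Rightarrow> real. (\<forall>i<length E. 0 \<le> p i \<and> p i \<le> 1) \<longrightarrow>
           (\<forall>t::real.
              measure_pmf.expectation (random_sublist E p)
                (\<lambda>A. poly (ehrhart_polynomial \<Gamma> (zonotope E A)) t)
              = multivariate_ehrhart \<Gamma> E (\<lambda>i. p i * t)))
       \<and> (\<forall>p::real. 0 < p \<and> p \<le> 1 \<longrightarrow>
           (\<forall>t::real. t \<noteq> 0 \<longrightarrow>
              measure_pmf.expectation (random_sublist E (\<lambda>_. p))
                (\<lambda>A. poly (ehrhart_polynomial \<Gamma> (zonotope E A)) t)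
              = (p * t) ^ rk E {..<length E}
                * arith_tutte {..<length E} (rk E) (multip \<Gamma> E) (1 + inverse (p * t)) 1))"
proof (intro conjI allI impI)
  note G = lattice_imp_discrete_subgroup[OF assms(1)]
  show "measure_pmf.expectation (random_sublist E p)
      (\<lambda>A. poly (ehrhart_polynomial \<Gamma> (zonotope E A)) t) = multivariate_ehrhart \<Gamma> E (\<lambda>i. p i * t)"
    if "\<forall>i<length E. 0 \<le> p i \<and> p i \<le> 1" for p t
    by (rule expectation_ehrhart_polynomial[OF G assms(2) that])
  show "measure_pmf.expectation (random_sublist E (\<lambda>_. p))
      (\<lambda>A. poly (ehrhart_polynomial \<Gamma> (zonotope E A)) t)
      = (p * t) ^ rk E {..<length E}
        * arith_tutte {..<length E} (rk E) (multip \<Gamma> E) (1 + inverse (p * t)) 1"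
    if p: "0 < p \<and> p \<le> 1" and t: "t \<noteq> 0" for p t :: real
  proof -
    have "p * t \<noteq> 0" using p t by simp
    from multivariate_ehrhart_const[OF G assms(2) this] show ?thesis
      using p by (subst expectation_ehrhart_polynomial[OF G assms(2)]) auto
  qed
qed

end
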